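(* Let $x(t)$, $t\in\mathbb{R}$, be a random signal belonging to the class NS1. If its power spectral density $S_x(\omega)$ is bandlimited with bandwidth $B$, then its generalized power spectral density $$K_x(u,v)=\int_{-\infty}^{\infty}\int_{-\infty}^{\infty}R_x(t_1,t_2)\,e^{-j(ut_1-vt_2)}\,dt_1\,dt_2$$ is bandlimited (in both dimensions) with the same bandwidth $B$.
   Context: Class NS1: a random signal $x(t)$ belongs to the class NS1 if it can be represented as the output of nonstationary white Gaussian noise $w(t)$ passed through a stable linear time invariant system with real impulse response $h(t)$, i.e. $x(t)=(w\star h)(t)$, where $\star$ denotes convolution; here $w(t)$ is a Gaussian process with $E[w(t)]=0$ for all $t$ and $R_w(t,t')=E[w(t)w(t')]=\sigma_w^2(t)\,\delta(t-t')$ with $\delta$ the Dirac delta, $\sigma_{w,\max}^2:=\max_t\sigma_w^2(t)<\infty$, and $h$ satisfies $\int_{-\infty}^{\infty}|h(t)|\,dt<\infty$. (The white noise is understood in the usual generalized sense, so that $x$ is a zero-mean Gaussian process with $R_x(t_1,t_2)=E[x(t_1)x(t_2)]=\int_{-\infty}^{\infty}\sigma_w^2(s)h(t_1-s)h(t_2-s)\,ds$.) Power spectral density: $S_x(\omega)=\lim_{T\to\infty}\frac{1}{2T}E[|X_T(\omega)|^2]$, where $X_T(\omega)=\int_{-T}^{T}x(t)e^{-j\omega t}\,dt$ and $j=\sqrt{-1}$. $S_x$ is bandlimited with bandwidth $B>0$ (in cycles per unit time) if $S_x(\omega)=0$ for all $|\omega|>2\pi B$. The generalized power spectral density $K_x$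 is the two-dimensional Fourier transform of the autocorrelation $R_x$ (with the sign convention displayed in the claim), understood in general in the sense of tempered distributions; it is bandlimited in both dimensions with bandwidth $B$ if it vanishes (as a distribution) on the set of $(u,v)$ with $|u|>2\pi B$ or $|v|>2\pi B$.
   Formalization: The power spectral density S_x is additionally assumed not identically zero; otherwise the claim fails, e.g. for noise of intensity 1 on [0,1] and 0 elsewhere with h(t)=exp(-t^2), where S_x=0 but K_x is not bandlimited. *)

theory Defs
  imports "HOL-Probability.Probability"
begin

section \<open>Gaussian families and nonstationary white noise\<close>

text \<open>Constants count as degenerate normal variables.\<close>
definition gaussian_rv :: "'a measure \<Rightarrow> ('a \<Rightarrow> real) \<Rightarrow> bool" where
  "gaussian_rv M X \<longleftrightarrow> X \<in> borel_measurable M \<and>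
     ((\<exists>m s. 0 < s \<and> distributed M lborel X (\<lambda>y. ennreal (normal_density m s y))) \<or>
      (\<exists>c. AE w in M. X w = c))"

definition gaussian_family :: "'a measure \<Rightarrow> 'i set \<Rightarrow> ('i \<Rightarrow> 'a \<Rightarrow> real) \<Rightarrow> bool" where
  "gaussian_family M I X \<longleftrightarrow>
     (\<forall>J c. finite J \<longrightarrow> J \<subseteq> I \<longrightarrow> gaussian_rv M (\<lambda>w. \<Sum>i\<in>J. c i * X i w))"

text \<open>The test functions for white noise of intensity \<open>\<sigma>2\<close> (the function written
  \<open>\<sigma>\<^sub>w\<^sup>2(t)\<close> in the mathematics): those square integrable for the measure \<open>\<sigma>2(s) ds\<close>.\<close>
definition noise_test_functions :: "(real \<Rightarrow> real) \<Rightarrow> (real \<Rightarrow> real) set" where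
  "noise_test_functions \<sigma>2 =
     {f. f \<in> borel_measurable borel \<and> integrable lborel (\<lambda>s. \<sigma>2 s * (f s)\<^sup>2)}"

text \<open>White noise has no values at points. It is given by its action
  \<open>W f = \<integral> w(s) f(s) ds\<close> on test functions. The formula
  \<open>E[w(t) w(t')] = \<sigma>2(t) \<delta>(t - t')\<close>, integrated against \<open>f(t) g(t')\<close>, is the last clause;
  almost sure linearity of \<open>W\<close> follows from it.\<close>
definition white_noise ::
    "'a measure \<Rightarrow> (real \<Rightarrow> real) \<Rightarrow> ((real \<Rightarrow> real) \<Rightarrow> 'a \<Rightarrow> real) \<Rightarrow> bool" where
  "white_noise M \<sigma>2 W \<longleftrightarrow>
     gaussian_family M (noise_test_functions \<sigma>2) W \<and>
     (\<forall>f \<in> noise_test_functions \<sigma>2. (\<integral>w. W f w \<partial>M) = 0) \<and>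
     (\<forall>f \<in> noise_test_functions \<sigma>2. \<forall>g \<in> noise_test_functions \<sigma>2.
        (\<integral>w. W f w * W g w \<partial>M) = (\<integral>s. \<sigma>2 s * f s * g s \<partial>lborel))"

section \<open>Random signals and the class NS1\<close>

definition random_signal :: "'a measure \<Rightarrow> (real \<Rightarrow> 'a \<Rightarrow> real) \<Rightarrow> bool" where
  "random_signal M x \<longleftrightarrow> case_prod x \<in> borel_measurable (lborel \<Otimes>\<^sub>M M)"

text \<open>\<open>(w \<star> h)(t) = \<integral> w(s) h(t - s) ds\<close> is \<open>W\<close> applied to \<open>s \<mapsto> h(t - s)\<close>. For it to be a
  random variable (with finite variance) this function must be a test function.
  Each \<open>W f\<close> is determined only up to null sets, so \<open>x(t)\<close> is compared with it almost surely.\<close>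
definition NS1 :: "'a measure \<Rightarrow> (real \<Rightarrow> 'a \<Rightarrow> real) \<Rightarrow> bool" where
  "NS1 M x \<longleftrightarrow> (\<exists>\<sigma>2 h W.
     \<sigma>2 \<in> borel_measurable borel \<and> (\<forall>t. 0 \<le> \<sigma>2 t) \<and> bdd_above (range \<sigma>2) \<and>
     white_noise M \<sigma>2 W \<and>
     integrable lborel h \<and>
     (\<forall>t. (\<lambda>s. h (t - s)) \<in> noise_test_functions \<sigma>2) \<and>
     (\<forall>t. AE w in M. x t w = W (\<lambda>s. h (t - s)) w))"

section \<open>Power spectral density\<close>

definition truncated_ft :: "(real \<Rightarrow> 'a \<Rightarrow> real) \<Rightarrow> real \<Rightarrow> real \<Rightarrow> 'a \<Rightarrow> complex" where
  "truncated_ft x T \<omega> w =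
     set_lebesgue_integral lborel {-T..T}
       (\<lambda>t. complex_of_real (x t w) * exp (- (\<i> * complex_of_real (\<omega> * t))))"

text \<open>The first two clauses say that the random integral defining \<open>X\<^sub>T(\<omega>)\<close> and the expectation
  of its squared modulus exist; otherwise the library would assign them the value 0.\<close>
definition has_psd :: "'a measure \<Rightarrow> (real \<Rightarrow> 'a \<Rightarrow> real) \<Rightarrow> (real \<Rightarrow> real) \<Rightarrow> bool" where
  "has_psd M x S \<longleftrightarrow>
     (\<forall>T>0. AE w in M. set_integrable lborel {-T..T} (\<lambda>t. x t w)) \<and>
     (\<forall>T>0. \<forall>\<omega>. integrable M (\<lambda>w. (cmod (truncated_ft x T \<omega> w))\<^sup>2)) \<and>
     (\<forall>\<omega>. ((\<lambda>T. 1 / (2 * T) * (\<integral>w. (cmod (truncated_ft x T \<omega> w))\<^sup>2 \<partial>M)) \<longlongrightarrow> S \<omega>) at_top)"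

definition bandlimited :: "(real \<Rightarrow> real) \<Rightarrow> real \<Rightarrow> bool" where
  "bandlimited S B \<longleftrightarrow> (\<forall>\<omega>. \<bar>\<omega>\<bar> > 2 * pi * B \<longrightarrow> S \<omega> = 0)"

section \<open>Generalized power spectral density\<close>

definition autocorrelation :: "'a measure \<Rightarrow> (real \<Rightarrow> 'a \<Rightarrow> real) \<Rightarrow> real \<times> real \<Rightarrow> real" where
  "autocorrelation M x = (\<lambda>(t1, t2). \<integral>w. x t1 w * x t2 w \<partial>M)"

primrec Ck :: "nat \<Rightarrow> (real \<times> real \<Rightarrow> complex) \<Rightarrow> bool" where
  "Ck 0 f \<longleftrightarrow> continuous_on UNIV f"
| "Ck (Suc n) f \<longleftrightarrow> (\<exists>f1 f2.
     (\<forall>p. (f has_derivative (\<lambda>v. fst v *\<^sub>R f1 p + snd v *\<^sub>R f2 p)) (at p)) \<and>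
     Ck n f1 \<and> Ck n f2)"

definition test_functions :: "(real \<times> real) set \<Rightarrow> (real \<times> real \<Rightarrow> complex) set" where
  "test_functions U =
     {\<phi>. (\<forall>n. Ck n \<phi>) \<and> compact (closure {p. \<phi> p \<noteq> 0}) \<and> closure {p. \<phi> p \<noteq> 0} \<subseteq> U}"

text \<open>The kernel \<open>e\<^bsup>-j(u t\<^sub>1 - v t\<^sub>2)\<^esup>\<close> has opposite signs in the two variables.\<close>
definition ft2 :: "(real \<times> real \<Rightarrow> complex) \<Rightarrow> real \<times> real \<Rightarrow> complex" where
  "ft2 f = (\<lambda>(t1, t2). \<integral>p. f p *
     exp (- (\<i> * complex_of_real (fst p * t1 - snd p * t2))) \<partial>lborel)"

text \<open>Integrability against a negative power of \<open>1 + |t|\<close> makes \<open>\<psi> \<mapsto> \<integral> R \<psi>\<close> converge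
  absolutely and continuously on Schwartz functions, i.e. makes \<open>R\<close> a tempered distribution.\<close>
definition tempered_function :: "(real \<times> real \<Rightarrow> real) \<Rightarrow> bool" where
  "tempered_function R \<longleftrightarrow> R \<in> borel_measurable borel \<and>
     (\<exists>N::nat. integrable lborel (\<lambda>t. R t / (1 + norm t) ^ N))"

text \<open>The distributional Fourier transform \<open>K\<close> of \<open>R\<close>, acting on \<open>\<phi>\<close>:
  \<open>\<langle>K, \<phi>\<rangle> = \<langle>R, ft2 \<phi>\<rangle>\<close> (the kernel is symmetric under exchanging \<open>(u, v)\<close> and
  \<open>(t\<^sub>1, t\<^sub>2)\<close>).\<close>
definition ft2_distribution :: "(real \<times> real \<Rightarrow> real) \<Rightarrow> (real \<times> real \<Rightarrow> complex) \<Rightarrow> complex" where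
  "ft2_distribution R \<phi> = (\<integral>t. complex_of_real (R t) * ft2 \<phi> t \<partial>lborel)"

definition gen_psd ::
    "'a measure \<Rightarrow> (real \<Rightarrow> 'a \<Rightarrow> real) \<Rightarrow> (real \<times> real \<Rightarrow> complex) \<Rightarrow> complex" where
  "gen_psd M x = ft2_distribution (autocorrelation M x)"

definition vanishes_on :: "((real \<times> real \<Rightarrow> complex) \<Rightarrow> complex) \<Rightarrow> (real \<times> real) set \<Rightarrow> bool" where
  "vanishes_on K U \<longleftrightarrow> (\<forall>\<phi> \<in> test_functions U. K \<phi> = 0)"

definition bandlimited2 :: "((real \<times> real \<Rightarrow> complex) \<Rightarrow> complex) \<Rightarrow> real \<Rightarrow> bool" where
  "bandlimited2 K B \<longleftrightarrow> vanishes_on K {(u, v). \<bar>u\<bar> > 2 * pi * B \<or> \<bar>v\<bar> > 2 * pi * B}"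

end

theory Submission
  imports Defs
begin

text \<open>
  Let \<open>H\<close> be the Fourier transform of the impulse response \<open>h\<close>. The idea is that the power
  spectral density of \<open>x\<close> is \<open>P |H|\<^sup>2\<close>, where \<open>P\<close> is the mean of the noise intensity over
  all time, so that the band limit passes from \<open>S\<close> to \<open>H\<close>; the generalized density of a
  filtered noise is in turn an integral of \<open>H(u) H(-v)\<close> times phases, so that it inherits the
  band limit from \<open>H\<close>.

  For the first half, \<open>E|X\<^sub>T(\<omega>)|\<^sup>2\<close> is the integral of \<open>\<sigma>2(s)\<close> times the squared
  modulus of the Fourier transform over the window \<open>[-T, T]\<close> of the response to an impulse at
  \<open>s\<close>. For an impulse inside the window this transform is \<open>H(\<omega>)\<close> up to a phase, and outside
  it is \<open>0\<close>, except for the part of the response which is cut off by an end of the window. The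
  total error over all \<open>s\<close> is of the order of the integral of \<open>|h(\<tau>)| min(|\<tau>|, T)\<close>, which is
  \<open>o(T)\<close> for every integrable \<open>h\<close> (\<open>windowed_energy_limit\<close>). So \<open>|H(\<omega>)|\<^sup>2\<close> times the
  mean intensity over \<open>[-T, T]\<close> tends to \<open>S(\<omega>)\<close>. At one frequency where \<open>S\<close> is not
  \<open>0\<close> this shows that the mean intensity has a limit other than \<open>0\<close>; hence \<open>H\<close> vanishes
  wherever \<open>S\<close> does (\<open>freq_response_eq_0\<close>).

  To compute \<open>E|X\<^sub>T(\<omega>)|\<^sup>2\<close> from the covariance, expectation and time integrals have to be
  exchanged. Since \<open>h\<close> is integrable but perhaps not square integrable, the variance of \<open>x(t)\<close>
  could be unbounded in \<open>t\<close>. Here Gaussianity enters: a centered Gaussian variable is, with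
  probability at least one half, no smaller in modulus than half its standard deviation, so a Gaussian signal whose paths are
  almost surely integrable on the window has a standard deviation integrable on the window
  (\<open>centered_gaussian_sd_integrable\<close>), and the exchange is justified by Cauchy-Schwarz
  (\<open>truncated_energy\<close>).

  For the second half, the Fourier transform of a test function decays like
  \<open>1 / (1 + t\<^sub>1\<^sup>2)\<close>; decay in the first variable alone suffices to make all integrals
  converge absolutely (\<open>kernel_integrable\<close>). After Fubini the distribution pairs the test
  function \<open>\<phi>(u, v)\<close> with \<open>H(u) H(-v)\<close>, which vanishes on the support of \<open>\<phi>\<close>
  (\<open>spectrum_vanishes\<close>).
\<close>

section \<open>Integrals on the line and in the plane\<close>

lemma nn_integral_abs_reflect:
  fixes h :: "real \<Rightarrow> real"
  assumes [measurable]: "h \<in> borel_measurable borel"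
  shows "(\<integral>\<^sup>+ s. ennreal \<bar>h (a - s)\<bar> \<partial>lborel) = (\<integral>\<^sup>+ s. ennreal \<bar>h s\<bar> \<partial>lborel)"
  by (subst (2) nn_integral_real_affine[where t = a and c = "-1"]) auto

lemma nn_integral_abs_translate:
  fixes h :: "real \<Rightarrow> real"
  assumes [measurable]: "h \<in> borel_measurable borel"
  shows "(\<integral>\<^sup>+ t. ennreal \<bar>h (t - a)\<bar> \<partial>lborel) = (\<integral>\<^sup>+ s. ennreal \<bar>h s\<bar> \<partial>lborel)"
  by (subst (2) nn_integral_real_affine[where t = "- a" and c = 1]) auto

lemma
  fixes f g :: "real \<Rightarrow> complex"
  assumes f: "integrable lborel f" and g: "integrable lborel g"
  shows integrable_tensor: "integrable lborel (\<lambda>t. f (fst t) * g (snd t))"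
    and integral_tensor: "(\<integral>t. f (fst t) * g (snd t) \<partial>lborel) = (\<integral>a. f a \<partial>lborel) * (\<integral>b. g b \<partial>lborel)"
proof -
  have [measurable]: "f \<in> borel_measurable borel" "g \<in> borel_measurable borel"
    using f g by (auto dest: borel_measurable_integrable)
  have i: "integrable (lborel \<Otimes>\<^sub>M lborel) (\<lambda>t. f (fst t) * g (snd t))"
    by (rule lborel_pair.Fubini_integrable) (use f g in \<open>auto simp: norm_mult\<close>)
  then show "integrable lborel (\<lambda>t. f (fst t) * g (snd t))"
    by (simp add: lborel_prod)
  show "(\<integral>t. f (fst t) * g (snd t) \<partial>lborel) = (\<integral>a. f a \<partial>lborel) * (\<integral>b. g b \<partial>lborel)"
    using lborel_pair.integral_fst'[OF i] by (simp add: lborel_prod)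
qed

text \<open>Moving a window of length \<open>2T\<close> by \<open>\<tau>\<close> changes it within \<open>\<bar>\<tau>\<bar>\<close> of its two ends only;
  and the symmetric difference of two such windows never has a measure above \<open>4T\<close>.\<close>
lemma nn_integral_indicator_shift_diff:
  fixes T \<tau> :: real
  assumes "0 \<le> T"
  shows "(\<integral>\<^sup>+ s. ennreal \<bar>indicat_real {-T..T} (s + \<tau>) - indicat_real {-T..T} s\<bar> \<partial>lborel)
    \<le> ennreal (4 * min \<bar>\<tau>\<bar> T)" (is "?D \<le> _")
proof -
  have "?D \<le> (\<integral>\<^sup>+ s. indicator {-T-\<bar>\<tau>\<bar>..-T+\<bar>\<tau>\<bar>} s + indicator {T-\<bar>\<tau>\<bar>..T+\<bar>\<tau>\<bar>} s \<partial>lborel)"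
    by (intro nn_integral_mono) (auto simp: indicator_def)
  also have "\<dots> = ennreal (4 * \<bar>\<tau>\<bar>)"
    by (subst nn_integral_add) (auto simp: ennreal_plus[symmetric] simp del: ennreal_plus)
  finally have 1: "?D \<le> ennreal (4 * \<bar>\<tau>\<bar>)" .
  have "?D \<le> (\<integral>\<^sup>+ s. indicator {-T-\<tau>..T-\<tau>} s + indicator {-T..T} s \<partial>lborel)"
    by (intro nn_integral_mono) (auto simp: indicator_def)
  also have "\<dots> = ennreal (4 * T)"
    using assms by (subst nn_integral_add) (auto simp: ennreal_plus[symmetric] simp del: ennreal_plus)
  finally have 2: "?D \<le> ennreal (4 * T)" .
  show ?thesis using 1 2 by (auto simp: min_def)
qed

lemma integrable_inverse_square: "integrable lborel (\<lambda>x::real. 1 / (1 + x\<^sup>2))"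
  using integrable_inverse_1_plus_square
  by (simp add: set_integrable_def einterval_def inverse_eq_divide)

lemma norm_exp_imaginary: "norm (exp (- (\<i> * complex_of_real a))) = 1"
  by simp

section \<open>The covariance of filtered white noise\<close>

locale noise_filter =
  fixes \<sigma>2 h :: "real \<Rightarrow> real" and C :: real
  assumes intensity_measurable [measurable]: "\<sigma>2 \<in> borel_measurable borel"
    and intensity_nonneg: "0 \<le> \<sigma>2 s"
    and intensity_le: "\<sigma>2 s \<le> C"
    and response_integrable: "integrable lborel h"
begin

lemma response_measurable [measurable]: "h \<in> borel_measurable borel"
  using borel_measurable_integrable[OF response_integrable] by simp

lemma bound_nonneg: "0 \<le> C"
  using intensity_nonneg intensity_le order_trans by blast

definition response_mass :: real where
  "response_mass = (\<integral>\<tau>. \<bar>h \<tau>\<bar> \<partial>lborel)"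

lemma nn_integral_response: "(\<integral>\<^sup>+ \<tau>. ennreal \<bar>h \<tau>\<bar> \<partial>lborel) = ennreal response_mass"
  unfolding response_mass_def
  by (rule nn_integral_eq_integral) (use response_integrable in auto)

lemma response_mass_nonneg: "0 \<le> response_mass"
  by (simp add: response_mass_def)

definition covariance :: "real \<times> real \<Rightarrow> real" where
  "covariance t = (\<integral>s. \<sigma>2 s * h (fst t - s) * h (snd t - s) \<partial>lborel)"

definition freq_response :: "real \<Rightarrow> complex" where
  "freq_response \<omega> = (\<integral>\<tau>. h \<tau> * exp (- (\<i> * complex_of_real (\<omega> * \<tau>))) \<partial>lborel)"

lemma covariance_measurable [measurable]: "covariance \<in> borel_measurable borel"
proof -
  have "covariance \<in> borel_measurable (lborel :: (real \<times> real) measure)"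
    unfolding covariance_def lborel_prod[symmetric] by measurable
  then show ?thesis by simp
qed

text \<open>The source of every exchange of integrals below. Integrating over the second time, then over
  \<open>s\<close>, then over the first time costs a factor \<open>\<parallel>h\<parallel>\<close>, another factor \<open>\<parallel>h\<parallel>\<close> and
  \<open>\<integral> k\<close>; that is why a bound on \<open>g\<close> in terms of the first time alone is enough, although
  the kernel itself need not decay along the diagonal.\<close>
lemma kernel_integrable:
  fixes g :: "real \<times> real \<Rightarrow> complex" and k :: "real \<Rightarrow> real"
  assumes [measurable]: "g \<in> borel_measurable borel" and k: "integrable lborel k"
    and gk: "\<And>a b. norm (g (a, b)) \<le> k a"
  shows "integrable (lborel \<Otimes>\<^sub>M lborel)
    (\<lambda>(t, s). complex_of_real (\<sigma>2 s * h (fst t - s) * h (snd t - s)) * g t)" (is "integrable _ ?F")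
proof (rule integrableI_bounded)
  have [measurable]: "k \<in> borel_measurable borel" using borel_measurable_integrable[OF k] by simp
  have k0: "0 \<le> k a" for a using gk[of a 0] norm_ge_zero order_trans by blast
  have [measurable]: "g \<in> borel_measurable (borel \<Otimes>\<^sub>M borel)"
    by (simp add: borel_prod assms)
  have "?F \<in> borel_measurable ((borel \<Otimes>\<^sub>M borel) \<Otimes>\<^sub>M borel)"
    by measurable
  then show mF: "?F \<in> borel_measurable (lborel \<Otimes>\<^sub>M lborel)"
    by (simp add: borel_prod lborel_prod)
  let ?I = "response_mass"
  have "(\<integral>\<^sup>+ p. norm (?F p) \<partial>(lborel \<Otimes>\<^sub>M lborel)) = (\<integral>\<^sup>+ s. \<integral>\<^sup>+ t. norm (?F (t, s)) \<partial>lborel \<partial>lborel)"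
    by (rule lborel_pair.nn_integral_snd[symmetric]) (use mF in measurable)
  also have "\<dots> \<le> (\<integral>\<^sup>+ s. ennreal (C * ?I) * (\<integral>\<^sup>+ a. ennreal \<bar>h (a - s)\<bar> * ennreal (k a) \<partial>lborel) \<partial>lborel)"
  proof (rule nn_integral_mono)
    fix s :: real
    have "(\<integral>\<^sup>+ t. norm (?F (t, s)) \<partial>lborel)
      \<le> (\<integral>\<^sup>+ t. ennreal C * (ennreal \<bar>h (fst t - s)\<bar> * ennreal (k (fst t)) * ennreal \<bar>h (snd t - s)\<bar>) \<partial>lborel)"
    proof (rule nn_integral_mono)
      fix t :: "real \<times> real"
      have "norm (?F (t, s)) = \<sigma>2 s * (\<bar>h (fst t - s)\<bar> * norm (g t) * \<bar>h (snd t - s)\<bar>)"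
        using intensity_nonneg[of s] by (simp add: norm_mult abs_mult)
      also have "\<dots> \<le> C * (\<bar>h (fst t - s)\<bar> * k (fst t) * \<bar>h (snd t - s)\<bar>)"
        using gk[of "fst t" "snd t"] k0 intensity_nonneg[of s] intensity_le[of s] bound_nonneg
        by (intro mult_mono) (auto intro!: mult_nonneg_nonneg)
      finally show "ennreal (norm (?F (t, s)))
          \<le> ennreal C * (ennreal \<bar>h (fst t - s)\<bar> * ennreal (k (fst t)) * ennreal \<bar>h (snd t - s)\<bar>)"
        using bound_nonneg k0 by (simp add: ennreal_mult[symmetric] ennreal_leI)
    qed
    also have "\<dots> = (\<integral>\<^sup>+ a. \<integral>\<^sup>+ b. ennreal C * (ennreal \<bar>h (a - s)\<bar> * ennreal (k a) * ennreal \<bar>h (b - s)\<bar>) \<partial>lborel \<partial>lborel)"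
      unfolding lborel_prod[symmetric] by (subst lborel.nn_integral_fst[symmetric]) auto
    also have "\<dots> = ennreal (C * ?I) * (\<integral>\<^sup>+ a. ennreal \<bar>h (a - s)\<bar> * ennreal (k a) \<partial>lborel)"
      using bound_nonneg response_mass_nonneg
      by (simp add: nn_integral_cmult nn_integral_multc nn_integral_abs_translate nn_integral_response ennreal_mult ac_simps)
    finally show "(\<integral>\<^sup>+ t. norm (?F (t, s)) \<partial>lborel) \<le> \<dots>" .
  qed
  also have "\<dots> = ennreal (C * ?I) * (\<integral>\<^sup>+ a. \<integral>\<^sup>+ s. ennreal \<bar>h (a - s)\<bar> * ennreal (k a) \<partial>lborel \<partial>lborel)"
    by (subst nn_integral_cmult, simp, subst lborel_pair.Fubini') auto
  also have "\<dots> = ennreal (C * ?I) * (ennreal ?I * (\<integral>\<^sup>+ a. ennreal (k a) \<partial>lborel))"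
    by (simp add: nn_integral_multc nn_integral_abs_reflect nn_integral_response nn_integral_cmult)
  also have "\<dots> < \<infinity>"
    using k k0 by (simp add: nn_integral_eq_integral ennreal_mult_less_top)
  finally show "(\<integral>\<^sup>+ p. norm (?F p) \<partial>(lborel \<Otimes>\<^sub>M lborel)) < \<infinity>" .
qed

lemma
  fixes g :: "real \<times> real \<Rightarrow> complex" and k :: "real \<Rightarrow> real"
  assumes g: "g \<in> borel_measurable borel" and k: "integrable lborel k"
    and gk: "\<And>a b. norm (g (a, b)) \<le> k a"
  shows covariance_integrable: "integrable lborel (\<lambda>t. complex_of_real (covariance t) * g t)"
    and covariance_integral: "(\<integral>t. complex_of_real (covariance t) * g t \<partial>lborel) =
      (\<integral>s. complex_of_real (\<sigma>2 s) *
        (\<integral>t. complex_of_real (h (fst t - s) * h (snd t - s)) * g t \<partial>lborel) \<partial>lborel)"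
    and covariance_inner_integrable: "integrable lborel (\<lambda>s. complex_of_real (\<sigma>2 s) *
        (\<integral>t. complex_of_real (h (fst t - s) * h (snd t - s)) * g t \<partial>lborel))"
proof -
  note i = kernel_integrable[OF assms]
  have e: "(\<integral>s. complex_of_real (\<sigma>2 s * h (fst t - s) * h (snd t - s)) * g t \<partial>lborel)
     = complex_of_real (covariance t) * g t" for t
  proof -
    have "(\<integral>s. complex_of_real (\<sigma>2 s * h (fst t - s) * h (snd t - s)) \<partial>lborel)
       = complex_of_real (covariance t)"
      unfolding covariance_def by (rule integral_complex_of_real)
    then show ?thesis by (subst integral_mult_left_zero) simp
  qed
  have e2: "(\<integral>t. complex_of_real (\<sigma>2 s * h (fst t - s) * h (snd t - s)) * g t \<partial>lborel)
     = complex_of_real (\<sigma>2 s) * (\<integral>t. complex_of_real (h (fst t - s) * h (snd t - s)) * g t \<partial>lborel)" for s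
    by (subst integral_mult_right_zero[symmetric]) (simp add: mult.assoc)
  show "integrable lborel (\<lambda>t. complex_of_real (covariance t) * g t)"
    using lborel_pair.integrable_fst[OF i] unfolding e .
  show "integrable lborel (\<lambda>s. complex_of_real (\<sigma>2 s) *
        (\<integral>t. complex_of_real (h (fst t - s) * h (snd t - s)) * g t \<partial>lborel))"
    using lborel_pair.integrable_snd[OF i] unfolding e2 .
  show "(\<integral>t. complex_of_real (covariance t) * g t \<partial>lborel) =
      (\<integral>s. complex_of_real (\<sigma>2 s) *
        (\<integral>t. complex_of_real (h (fst t - s) * h (snd t - s)) * g t \<partial>lborel) \<partial>lborel)"
    using lborel_pair.Fubini_integral[OF i] unfolding e e2 by simp
qed
end

section \<open>Time-averaged energy of filtered white noise\<close>

context noise_filter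
begin

text \<open>The Fourier transform, cut off to \<open>[-T, T]\<close>, of the response to an impulse at time \<open>s\<close>.\<close>
definition windowed :: "real \<Rightarrow> real \<Rightarrow> real \<Rightarrow> complex" where
  "windowed T \<omega> s = (\<integral>t. h (t - s) * (indicator {-T..T} t * exp (- (\<i> * complex_of_real (\<omega> * t)))) \<partial>lborel)"

text \<open>The mass of the response to an impulse at \<open>s\<close> that lies on the other side of a window end:
  outside the window when \<open>s\<close> is inside, and inside when \<open>s\<close> is outside.\<close>
definition edge :: "real \<Rightarrow> real \<Rightarrow> real" where
  "edge T s = (\<integral>\<tau>. \<bar>h \<tau>\<bar> * \<bar>indicat_real {-T..T} (s + \<tau>) - indicat_real {-T..T} s\<bar> \<partial>lborel)"

lemma windowed_measurable [measurable]: "windowed T \<omega> \<in> borel_measurable borel"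
proof -
  have "windowed T \<omega> \<in> borel_measurable lborel"
    unfolding windowed_def by measurable
  then show ?thesis by simp
qed

lemma windowed_shift:
  "windowed T \<omega> s = exp (- (\<i> * complex_of_real (\<omega> * s))) *
     (\<integral>\<tau>. h \<tau> * (indicator {-T..T} (s + \<tau>) * exp (- (\<i> * complex_of_real (\<omega> * \<tau>)))) \<partial>lborel)"
proof -
  have "exp (- (\<i> * complex_of_real (\<omega> * (s + \<tau>))))
      = exp (- (\<i> * complex_of_real (\<omega> * s))) * exp (- (\<i> * complex_of_real (\<omega> * \<tau>)))" for \<tau>
    by (simp add: mult_exp_exp distrib_left)
  then show ?thesis
    unfolding windowed_def
    by (subst lborel_integral_real_affine[where t = s and c = 1], simp,
        subst integral_mult_right_zero[symmetric]) (simp add: mult_ac)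
qed

lemma response_modulated_integrable:
  assumes [measurable]: "f \<in> borel_measurable borel" and "\<And>\<tau>. norm (f \<tau>) \<le> 1"
  shows "integrable lborel (\<lambda>\<tau>. complex_of_real (h \<tau>) * f \<tau>)"
  by (rule Bochner_Integration.integrable_bound[OF response_integrable])
     (use assms(2) in \<open>auto simp: norm_mult intro!: mult_left_le\<close>)

lemma response_modulated_bound:
  assumes "f \<in> borel_measurable borel" and "\<And>\<tau>. norm (f \<tau>) \<le> 1"
  shows "norm (\<integral>\<tau>. complex_of_real (h \<tau>) * f \<tau> \<partial>lborel) \<le> response_mass"
  unfolding response_mass_def
proof (rule Bochner_Integration.integral_norm_bound_integral)
  show "integrable lborel (\<lambda>\<tau>. complex_of_real (h \<tau>) * f \<tau>)"
    using assms by (rule response_modulated_integrable)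
qed (use response_integrable assms(2) in \<open>auto simp: norm_mult intro!: mult_left_le\<close>)

lemma windowed_bound: "norm (windowed T \<omega> s) \<le> response_mass"
  unfolding windowed_shift norm_mult
  by (simp, rule response_modulated_bound) (auto simp: norm_mult indicator_def)

lemma freq_response_bound: "norm (freq_response \<omega>) \<le> response_mass"
  unfolding freq_response_def by (rule response_modulated_bound) (auto simp: norm_mult)

text \<open>Both sides are integrals of \<open>h(\<tau>)\<close> against the same phases, once with the indicator of the window taken at
  \<open>s + \<tau>\<close> and once at \<open>s\<close>; so the difference is bounded by \<open>edge\<close>.\<close>
lemma windowed_approx:
  "norm (windowed T \<omega> s - exp (- (\<i> * complex_of_real (\<omega> * s))) * (indicator {-T..T} s * freq_response \<omega>))
     \<le> edge T s"
proof -
  let ?e = "\<lambda>\<tau>. exp (- (\<i> * complex_of_real (\<omega> * \<tau>)))"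
  let ?f = "\<lambda>\<tau>. complex_of_real (h \<tau>) * (indicator {-T..T} (s + \<tau>) * ?e \<tau>)"
  let ?g = "\<lambda>\<tau>. complex_of_real (h \<tau>) * (indicator {-T..T} s * ?e \<tau>)"
  have f: "integrable lborel ?f"
    by (rule response_modulated_integrable) (auto simp: norm_mult indicator_def)
  have g: "integrable lborel ?g"
    by (rule response_modulated_integrable) (auto simp: norm_mult indicator_def)
  have eq: "windowed T \<omega> s - ?e s * (indicator {-T..T} s * freq_response \<omega>) = ?e s * (\<integral>\<tau>. ?f \<tau> - ?g \<tau> \<partial>lborel)"
  proof -
    have "(\<integral>\<tau>. ?g \<tau> \<partial>lborel) = indicator {-T..T} s * freq_response \<omega>"
      unfolding freq_response_def
      by (subst integral_mult_right_zero[symmetric]) (simp only: mult.left_commute)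
    then show ?thesis
      unfolding windowed_shift Bochner_Integration.integral_diff[OF f g]
      by (simp only: right_diff_distrib)
  qed
  have "norm (windowed T \<omega> s - ?e s * (indicator {-T..T} s * freq_response \<omega>)) = norm (\<integral>\<tau>. ?f \<tau> - ?g \<tau> \<partial>lborel)"
    unfolding eq norm_mult norm_exp_imaginary by (rule mult_1)
  also have "\<dots> \<le> edge T s"
    unfolding edge_def
  proof (rule Bochner_Integration.integral_norm_bound_integral)
    show "integrable lborel (\<lambda>\<tau>. ?f \<tau> - ?g \<tau>)"
      by (rule Bochner_Integration.integrable_diff[OF f g])
    show "integrable lborel (\<lambda>\<tau>. \<bar>h \<tau>\<bar> * \<bar>indicat_real {-T..T} (s + \<tau>) - indicat_real {-T..T} s\<bar>)"
    proof (rule Bochner_Integration.integrable_bound[OF response_integrable])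
      show "AE \<tau> in lborel. norm (\<bar>h \<tau>\<bar> * \<bar>indicat_real {-T..T} (s + \<tau>) - indicat_real {-T..T} s\<bar>) \<le> norm (h \<tau>)"
        by (rule AE_I2) (simp add: abs_mult mult_left_le indicator_def)
    qed measurable
    show "norm (?f \<tau> - ?g \<tau>) \<le> \<bar>h \<tau>\<bar> * \<bar>indicat_real {-T..T} (s + \<tau>) - indicat_real {-T..T} s\<bar>" for \<tau>
      by (cases "s + \<tau> \<in> {-T..T}"; cases "s \<in> {-T..T}") (simp_all add: norm_mult)
  qed
  finally show ?thesis .
qed

lemma windowed_energy_approx:
  "\<bar>(norm (windowed T \<omega> s))\<^sup>2 - (norm (freq_response \<omega>))\<^sup>2 * indicator {-T..T} s\<bar>
     \<le> 2 * response_mass * edge T s"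
proof -
  let ?b = "exp (- (\<i> * complex_of_real (\<omega> * s))) * (indicator {-T..T} s * freq_response \<omega>)"
  have b: "norm ?b = norm (freq_response \<omega>) * indicator {-T..T} s"
    by (auto simp: norm_mult indicator_def)
  have nb: "norm ?b \<le> response_mass"
    unfolding b using freq_response_bound[of \<omega>] response_mass_nonneg by (auto simp: indicator_def)
  have eq: "(norm (windowed T \<omega> s))\<^sup>2 - (norm (freq_response \<omega>))\<^sup>2 * indicator {-T..T} s
     = (norm (windowed T \<omega> s))\<^sup>2 - (norm ?b)\<^sup>2"
    unfolding b by (auto simp: indicator_def)
  have eq2: "(norm (windowed T \<omega> s))\<^sup>2 - (norm ?b)\<^sup>2 = (norm (windowed T \<omega> s) + norm ?b) * (norm (windowed T \<omega> s) - norm ?b)"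
    by (simp add: power2_eq_square algebra_simps)
  have "\<bar>(norm (windowed T \<omega> s))\<^sup>2 - (norm (freq_response \<omega>))\<^sup>2 * indicator {-T..T} s\<bar>
     \<le> (response_mass + response_mass) * norm (windowed T \<omega> s - ?b)"
    unfolding eq eq2 abs_mult
    using windowed_bound[of T \<omega> s] nb response_mass_nonneg
    by (intro mult_mono norm_triangle_ineq3) simp_all
  also have "\<dots> \<le> (response_mass + response_mass) * edge T s"
    using response_mass_nonneg windowed_approx by (intro mult_left_mono) auto
  finally show ?thesis by (simp add: algebra_simps)
qed

lemma
  assumes T: "0 < T"
  shows edge_integrable: "integrable lborel (edge T)"
    and edge_integral_le: "(\<integral>s. edge T s \<partial>lborel) \<le> (\<integral>\<tau>. \<bar>h \<tau>\<bar> * (4 * min \<bar>\<tau>\<bar> T) \<partial>lborel)"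
proof -
  let ?G = "\<lambda>(s, \<tau>). \<bar>h \<tau>\<bar> * \<bar>indicat_real {-T..T} (s + \<tau>) - indicat_real {-T..T} s\<bar>"
  have "\<bar>h x\<bar> * min \<bar>x\<bar> T \<le> T * \<bar>h x\<bar>" for x
    by (subst mult.commute, rule mult_right_mono) auto
  note min_le = this
  have i: "integrable lborel (\<lambda>\<tau>. \<bar>h \<tau>\<bar> * (4 * min \<bar>\<tau>\<bar> T))"
    by (rule Bochner_Integration.integrable_bound[where f = "\<lambda>\<tau>. h \<tau> * (4 * T)"])
       (use T response_integrable min_le in \<open>auto simp: abs_mult\<close>)
  have m: "?G \<in> borel_measurable (lborel \<Otimes>\<^sub>M lborel)"
    by measurable
  have "(\<integral>\<^sup>+ p. ennreal (?G p) \<partial>(lborel \<Otimes>\<^sub>M lborel)) = (\<integral>\<^sup>+ \<tau>. \<integral>\<^sup>+ s. ennreal (?G (s, \<tau>)) \<partial>lborel \<partial>lborel)"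
    by (rule lborel_pair.nn_integral_snd[symmetric]) (use m in measurable)
  also have "\<dots> \<le> (\<integral>\<^sup>+ \<tau>. ennreal (\<bar>h \<tau>\<bar> * (4 * min \<bar>\<tau>\<bar> T)) \<partial>lborel)"
  proof (rule nn_integral_mono)
    fix \<tau> :: real
    have "(\<integral>\<^sup>+ s. ennreal (?G (s, \<tau>)) \<partial>lborel) =
      ennreal \<bar>h \<tau>\<bar> * (\<integral>\<^sup>+ s. ennreal \<bar>indicat_real {-T..T} (s + \<tau>) - indicat_real {-T..T} s\<bar> \<partial>lborel)"
      by (simp add: ennreal_mult nn_integral_cmult)
    also have "\<dots> \<le> ennreal \<bar>h \<tau>\<bar> * ennreal (4 * min \<bar>\<tau>\<bar> T)"
      using T by (intro mult_left_mono nn_integral_indicator_shift_diff) auto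
    finally show "(\<integral>\<^sup>+ s. ennreal (?G (s, \<tau>)) \<partial>lborel) \<le> ennreal (\<bar>h \<tau>\<bar> * (4 * min \<bar>\<tau>\<bar> T))"
      using T by (simp add: ennreal_mult)
  qed
  also have "\<dots> = ennreal (\<integral>\<tau>. \<bar>h \<tau>\<bar> * (4 * min \<bar>\<tau>\<bar> T) \<partial>lborel)"
    by (rule nn_integral_eq_integral[OF i]) (use T in auto)
  finally have le: "(\<integral>\<^sup>+ p. ennreal (?G p) \<partial>(lborel \<Otimes>\<^sub>M lborel))
      \<le> ennreal (\<integral>\<tau>. \<bar>h \<tau>\<bar> * (4 * min \<bar>\<tau>\<bar> T) \<partial>lborel)" .
  have G: "integrable (lborel \<Otimes>\<^sub>M lborel) ?G"
    by (rule integrableI_nonneg[OF m _ le_less_trans[OF le]]) auto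
  have "integrable lborel (\<lambda>s. edge T s)"
    unfolding edge_def using lborel_pair.integrable_fst[OF G] by simp
  then show "integrable lborel (edge T)" by simp
  have G_eq: "ennreal (\<integral>p. ?G p \<partial>(lborel \<Otimes>\<^sub>M lborel)) = (\<integral>\<^sup>+ p. ennreal (?G p) \<partial>(lborel \<Otimes>\<^sub>M lborel))"
    by (rule nn_integral_eq_integral[OF G, symmetric]) auto
  have nonneg: "0 \<le> (\<integral>\<tau>. \<bar>h \<tau>\<bar> * (4 * min \<bar>\<tau>\<bar> T) \<partial>lborel)"
    using T by (intro Bochner_Integration.integral_nonneg) auto
  have "(\<integral>p. ?G p \<partial>(lborel \<Otimes>\<^sub>M lborel)) \<le> (\<integral>\<tau>. \<bar>h \<tau>\<bar> * (4 * min \<bar>\<tau>\<bar> T) \<partial>lborel)"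
    by (rule ennreal_le_iff[OF nonneg, THEN iffD1]) (simp only: G_eq le)
  then show "(\<integral>s. edge T s \<partial>lborel) \<le> (\<integral>\<tau>. \<bar>h \<tau>\<bar> * (4 * min \<bar>\<tau>\<bar> T) \<partial>lborel)"
    unfolding edge_def using lborel_pair.integral_fst[OF G] by simp
qed

text \<open>With \<open>edge_integral_le\<close> this says that the ends of the window do not matter in the time average:
  \<open>min(\<bar>\<tau>\<bar>, T) / T\<close> is at most \<open>1\<close> and tends to \<open>0\<close> for each \<open>\<tau>\<close>, so dominated
  convergence applies with no decay of \<open>h\<close> beyond integrability.\<close>
lemma edge_negligible:
  "((\<lambda>T. (\<integral>\<tau>. \<bar>h \<tau>\<bar> * (4 * min \<bar>\<tau>\<bar> T) \<partial>lborel) / T) \<longlongrightarrow> 0) at_top"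
proof -
  have "((\<lambda>T. \<integral>\<tau>. \<bar>h \<tau>\<bar> * (4 * min \<bar>\<tau>\<bar> T) / T \<partial>lborel) \<longlongrightarrow> (\<integral>\<tau>. 0 \<partial>(lborel :: real measure))) at_top"
  proof (rule integral_dominated_convergence_at_top[where w = "\<lambda>\<tau>. 4 * \<bar>h \<tau>\<bar>"])
    show "integrable lborel (\<lambda>\<tau>. 4 * \<bar>h \<tau>\<bar>)" using response_integrable by simp
    show "\<forall>\<^sub>F T in at_top. AE \<tau> in lborel. norm (\<bar>h \<tau>\<bar> * (4 * min \<bar>\<tau>\<bar> T) / T) \<le> 4 * \<bar>h \<tau>\<bar>"
      using eventually_gt_at_top[of 0]
      by eventually_elim (auto simp: abs_mult min_def field_simps intro!: AE_I2 impI mult_right_mono)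
    show "AE \<tau> in lborel. ((\<lambda>T. \<bar>h \<tau>\<bar> * (4 * min \<bar>\<tau>\<bar> T) / T) \<longlongrightarrow> 0) at_top"
    proof (rule AE_I2)
      fix \<tau> :: real
      have "((\<lambda>T. \<bar>h \<tau>\<bar> * (4 * \<bar>\<tau>\<bar>) / T) \<longlongrightarrow> 0) at_top"
        by (rule tendsto_divide_0[OF tendsto_const filterlim_at_top_imp_at_infinity[OF filterlim_ident]])
      then show "((\<lambda>T. \<bar>h \<tau>\<bar> * (4 * min \<bar>\<tau>\<bar> T) / T) \<longlongrightarrow> 0) at_top"
        by (rule Lim_transform_eventually)
           (use eventually_ge_at_top[of "\<bar>\<tau>\<bar>"] in \<open>eventually_elim, auto simp: min_def\<close>)
    qed
  qed auto
  then show ?thesis by simp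
qed

lemma intensity_window_integrable: "integrable lborel (\<lambda>s. \<sigma>2 s * indicat_real {-T..T} s)"
  by (rule integrableI_bounded_set[where A = "{-T..T}" and B = C])
     (use intensity_nonneg intensity_le in \<open>auto simp: emeasure_lborel_Icc_eq\<close>)

text \<open>Inside the window the energy density is \<open>\<bar>H(\<omega>)\<bar>\<^sup>2\<close>, outside it is \<open>0\<close>, up to
  a multiple of \<open>edge\<close>. The mean intensity may a priori oscillate with \<open>T\<close>, hence the limit of
  the difference.\<close>
lemma windowed_energy_limit:
  assumes int: "\<And>T. 0 < T \<Longrightarrow> integrable lborel (\<lambda>s. \<sigma>2 s * (norm (windowed T \<omega> s))\<^sup>2)"
  shows "((\<lambda>T. 1 / (2 * T) * (\<integral>s. \<sigma>2 s * (norm (windowed T \<omega> s))\<^sup>2 \<partial>lborel)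
      - (norm (freq_response \<omega>))\<^sup>2 * (1 / (2 * T) * (\<integral>s. \<sigma>2 s * indicat_real {-T..T} s \<partial>lborel))) \<longlongrightarrow> 0) at_top"
proof (rule Lim_null_comparison)
  let ?E = "\<lambda>T. (\<integral>\<tau>. \<bar>h \<tau>\<bar> * (4 * min \<bar>\<tau>\<bar> T) \<partial>lborel)"
  show "((\<lambda>T. C * response_mass * (?E T / T)) \<longlongrightarrow> 0) at_top"
    using tendsto_mult_right_zero[OF edge_negligible] .
  show "\<forall>\<^sub>F T in at_top. norm (1 / (2 * T) * (\<integral>s. \<sigma>2 s * (norm (windowed T \<omega> s))\<^sup>2 \<partial>lborel)
      - (norm (freq_response \<omega>))\<^sup>2 * (1 / (2 * T) * (\<integral>s. \<sigma>2 s * indicat_real {-T..T} s \<partial>lborel)))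
      \<le> C * response_mass * (?E T / T)"
    using eventually_gt_at_top[of 0]
  proof eventually_elim
    fix T :: real assume T: "0 < T"
    let ?d = "\<lambda>s. \<sigma>2 s * (norm (windowed T \<omega> s))\<^sup>2 - (norm (freq_response \<omega>))\<^sup>2 * (\<sigma>2 s * indicat_real {-T..T} s)"
    have d: "integrable lborel ?d"
      using int[OF T] intensity_window_integrable by auto
    have eq: "1 / (2 * T) * (\<integral>s. \<sigma>2 s * (norm (windowed T \<omega> s))\<^sup>2 \<partial>lborel)
        - (norm (freq_response \<omega>))\<^sup>2 * (1 / (2 * T) * (\<integral>s. \<sigma>2 s * indicat_real {-T..T} s \<partial>lborel))
        = 1 / (2 * T) * (\<integral>s. ?d s \<partial>lborel)"
    proof -
      have "(\<integral>s. ?d s \<partial>lborel) = (\<integral>s. \<sigma>2 s * (norm (windowed T \<omega> s))\<^sup>2 \<partial>lborel)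
          - (norm (freq_response \<omega>))\<^sup>2 * (\<integral>s. \<sigma>2 s * indicat_real {-T..T} s \<partial>lborel)"
        using int[OF T] intensity_window_integrable[of T]
        by (subst Bochner_Integration.integral_diff) auto
      then show ?thesis by (simp add: right_diff_distrib)
    qed
    have "\<bar>\<integral>s. ?d s \<partial>lborel\<bar> \<le> (\<integral>s. C * (2 * response_mass * edge T s) \<partial>lborel)"
      unfolding real_norm_def[symmetric]
    proof (rule Bochner_Integration.integral_norm_bound_integral[OF d])
      show "integrable lborel (\<lambda>s. C * (2 * response_mass * edge T s))"
        using edge_integrable[OF T] by simp
      show "norm (?d s) \<le> C * (2 * response_mass * edge T s)" for s
      proof -
        have "?d s = \<sigma>2 s * ((norm (windowed T \<omega> s))\<^sup>2 - (norm (freq_response \<omega>))\<^sup>2 * indicator {-T..T} s)"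
          by (simp add: right_diff_distrib)
        then have "norm (?d s) = \<sigma>2 s * \<bar>(norm (windowed T \<omega> s))\<^sup>2 - (norm (freq_response \<omega>))\<^sup>2 * indicator {-T..T} s\<bar>"
          using intensity_nonneg[of s] by (simp only: real_norm_def abs_mult abs_of_nonneg)
        also have "\<dots> \<le> C * (2 * response_mass * edge T s)"
          using intensity_nonneg[of s] intensity_le[of s] windowed_energy_approx[of T \<omega> s] bound_nonneg
          by (intro mult_mono) auto
        finally show ?thesis .
      qed
    qed
    also have "\<dots> = C * 2 * response_mass * (\<integral>s. edge T s \<partial>lborel)" by simp
    also have "\<dots> \<le> C * 2 * response_mass * ?E T"
      using edge_integral_le[OF T] bound_nonneg response_mass_nonneg by (intro mult_left_mono) auto
    finally have le: "\<bar>\<integral>s. ?d s \<partial>lborel\<bar> \<le> C * 2 * response_mass * ?E T" .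
    show "norm (1 / (2 * T) * (\<integral>s. \<sigma>2 s * (norm (windowed T \<omega> s))\<^sup>2 \<partial>lborel)
      - (norm (freq_response \<omega>))\<^sup>2 * (1 / (2 * T) * (\<integral>s. \<sigma>2 s * indicat_real {-T..T} s \<partial>lborel)))
      \<le> C * response_mass * (?E T / T)"
      unfolding eq using le T by (simp add: abs_mult field_simps)
  qed
qed

lemma
  fixes T \<omega> :: real and g :: "real \<times> real \<Rightarrow> complex"
  assumes T: "0 < T"
  defines "g \<equiv> \<lambda>t. indicator {-T..T} (fst t) * indicator {-T..T} (snd t) *
      exp (- (\<i> * complex_of_real (\<omega> * (fst t - snd t))))"
  shows windowed_energy_integrable: "integrable lborel (\<lambda>s. \<sigma>2 s * (norm (windowed T \<omega> s))\<^sup>2)"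
    and windowed_energy: "(\<integral>t. complex_of_real (covariance t) * g t \<partial>lborel)
      = complex_of_real (\<integral>s. \<sigma>2 s * (norm (windowed T \<omega> s))\<^sup>2 \<partial>lborel)"
proof -
  have "g \<in> borel_measurable (borel \<Otimes>\<^sub>M borel)"
    unfolding g_def by measurable
  then have g: "g \<in> borel_measurable borel" by (simp add: borel_prod)
  have k: "integrable lborel (indicat_real {-T..T})"
    using T by (auto simp: emeasure_lborel_Icc_eq)
  have gk: "norm (g (a, b)) \<le> indicat_real {-T..T} a" for a b
    by (auto simp: g_def norm_mult indicator_def)
  have inner: "(\<integral>t. complex_of_real (h (fst t - s) * h (snd t - s)) * g t \<partial>lborel)
      = complex_of_real ((norm (windowed T \<omega> s))\<^sup>2)" for s
  proof -
    let ?f = "\<lambda>t. complex_of_real (h (t - s)) * (indicator {-T..T} t * exp (- (\<i> * complex_of_real (\<omega> * t))))"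
    have hs: "integrable lborel (\<lambda>t. h (t - s))"
      using lborel_integrable_real_affine[OF response_integrable, of 1 "- s"] by simp
    have f: "integrable lborel ?f"
      by (rule Bochner_Integration.integrable_bound[OF hs]) (auto simp: norm_mult indicator_def)
    have "complex_of_real ((norm (windowed T \<omega> s))\<^sup>2) = windowed T \<omega> s * cnj (windowed T \<omega> s)"
      by (rule complex_norm_square)
    also have "\<dots> = (\<integral>a. ?f a \<partial>lborel) * (\<integral>b. cnj (?f b) \<partial>lborel)"
      by (simp only: windowed_def Bochner_Integration.integral_cnj)
    also have "\<dots> = (\<integral>t. ?f (fst t) * cnj (?f (snd t)) \<partial>lborel)"
      by (rule integral_tensor[symmetric, OF f integrable_cnj[OF f]])
    also have "\<dots> = (\<integral>t. complex_of_real (h (fst t - s) * h (snd t - s)) * g t \<partial>lborel)"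
    proof (rule Bochner_Integration.integral_cong)
      fix t :: "real \<times> real"
      have "exp (- (\<i> * complex_of_real (\<omega> * (fst t - snd t))))
          = exp (- (\<i> * complex_of_real (\<omega> * fst t))) * cnj (exp (- (\<i> * complex_of_real (\<omega> * snd t))))"
        by (simp add: exp_cnj mult_exp_exp right_diff_distrib)
      then show "?f (fst t) * cnj (?f (snd t)) = complex_of_real (h (fst t - s) * h (snd t - s)) * g t"
        unfolding g_def by (simp only: complex_cnj_mult) (auto simp: indicator_def)
    qed simp
    finally show ?thesis by simp
  qed
  show "integrable lborel (\<lambda>s. \<sigma>2 s * (norm (windowed T \<omega> s))\<^sup>2)"
    using covariance_inner_integrable[OF g k gk]
    unfolding inner of_real_mult[symmetric] complex_of_real_integrable_eq .
  show "(\<integral>t. complex_of_real (covariance t) * g t \<partial>lborel)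
      = complex_of_real (\<integral>s. \<sigma>2 s * (norm (windowed T \<omega> s))\<^sup>2 \<partial>lborel)"
    using covariance_integral[OF g k gk]
    unfolding inner of_real_mult[symmetric] integral_complex_of_real .
qed

text \<open>A frequency \<open>\<omega>0\<close> with \<open>S(\<omega>0) \<noteq> 0\<close> fixes the mean intensity as the nonzero number
  \<open>S(\<omega>0) / \<bar>H(\<omega>0)\<bar>\<^sup>2\<close>. At any other frequency \<open>S\<close> is this number times
  \<open>\<bar>H\<bar>\<^sup>2\<close>.\<close>
lemma freq_response_eq_0:
  assumes lim: "\<And>\<omega>. ((\<lambda>T. 1 / (2 * T) * (\<integral>s. \<sigma>2 s * (norm (windowed T \<omega> s))\<^sup>2 \<partial>lborel)) \<longlongrightarrow> S \<omega>) at_top"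
    and S0: "S \<omega>0 \<noteq> 0" and S: "S \<omega> = 0"
  shows "freq_response \<omega> = 0"
proof -
  let ?m = "\<lambda>T. 1 / (2 * T) * (\<integral>s. \<sigma>2 s * indicat_real {-T..T} s \<partial>lborel)"
  have conv: "((\<lambda>T. (norm (freq_response \<nu>))\<^sup>2 * ?m T) \<longlongrightarrow> S \<nu>) at_top" for \<nu>
    using tendsto_diff[OF lim windowed_energy_limit[OF windowed_energy_integrable], of \<nu> \<nu>] by simp
  have H0: "freq_response \<omega>0 \<noteq> 0"
  proof
    assume "freq_response \<omega>0 = 0"
    then have "((\<lambda>T::real. 0::real) \<longlongrightarrow> S \<omega>0) at_top" using conv[of \<omega>0] by simp
    from tendsto_unique[OF _ this tendsto_const] show False using S0 by simp
  qed
  have "((\<lambda>T. (norm (freq_response \<omega>0))\<^sup>2 * ?m T / (norm (freq_response \<omega>0))\<^sup>2) \<longlongrightarrow> S \<omega>0 / (norm (freq_response \<omega>0))\<^sup>2) at_top"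
    by (rule tendsto_divide[OF conv tendsto_const]) (use H0 in simp)
  then have "(?m \<longlongrightarrow> S \<omega>0 / (norm (freq_response \<omega>0))\<^sup>2) at_top"
    using H0 by simp
  from tendsto_mult[OF tendsto_const this]
  have "((\<lambda>T. (norm (freq_response \<omega>))\<^sup>2 * ?m T) \<longlongrightarrow> (norm (freq_response \<omega>))\<^sup>2 * (S \<omega>0 / (norm (freq_response \<omega>0))\<^sup>2)) at_top" .
  from tendsto_unique[OF trivial_limit_at_top_linorder this conv[of \<omega>]]
  have "(norm (freq_response \<omega>))\<^sup>2 * (S \<omega>0 / (norm (freq_response \<omega>0))\<^sup>2) = 0"
    by (simp only: S)
  then show ?thesis using S0 H0 by simp
qed

end

section \<open>Gaussian signals with integrable paths\<close>

lemma integrable_abs_mult_of_squares: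
  fixes X Y :: "'a \<Rightarrow> real"
  assumes [measurable]: "X \<in> borel_measurable M" "Y \<in> borel_measurable M"
    and "integrable M (\<lambda>w. (X w)\<^sup>2)" "integrable M (\<lambda>w. (Y w)\<^sup>2)"
  shows "integrable M (\<lambda>w. \<bar>X w\<bar> * \<bar>Y w\<bar>)"
proof (rule Bochner_Integration.integrable_bound)
  show "integrable M (\<lambda>w. (X w)\<^sup>2 + (Y w)\<^sup>2)" using assms by simp
  show "AE w in M. norm (\<bar>X w\<bar> * \<bar>Y w\<bar>) \<le> norm ((X w)\<^sup>2 + (Y w)\<^sup>2)"
  proof (rule AE_I2)
    fix w
    have "2 * (\<bar>X w\<bar> * \<bar>Y w\<bar>) \<le> (X w)\<^sup>2 + (Y w)\<^sup>2"
      using sum_squares_bound[of "\<bar>X w\<bar>" "\<bar>Y w\<bar>"] by simp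
    moreover have "0 \<le> \<bar>X w\<bar> * \<bar>Y w\<bar>" by simp
    ultimately have "\<bar>X w\<bar> * \<bar>Y w\<bar> \<le> (X w)\<^sup>2 + (Y w)\<^sup>2" by linarith
    then show "norm (\<bar>X w\<bar> * \<bar>Y w\<bar>) \<le> norm ((X w)\<^sup>2 + (Y w)\<^sup>2)" by (simp add: abs_mult)
  qed
qed measurable

lemma integral_abs_mult_le:
  fixes X Y :: "'a \<Rightarrow> real"
  assumes [measurable]: "X \<in> borel_measurable M" "Y \<in> borel_measurable M"
    and X: "integrable M (\<lambda>w. (X w)\<^sup>2)" and Y: "integrable M (\<lambda>w. (Y w)\<^sup>2)"
  shows "(\<integral>w. \<bar>X w\<bar> * \<bar>Y w\<bar> \<partial>M) \<le> sqrt (\<integral>w. (X w)\<^sup>2 \<partial>M) * sqrt (\<integral>w. (Y w)\<^sup>2 \<partial>M)"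
proof -
  let ?a = "\<integral>w. (X w)\<^sup>2 \<partial>M" and ?b = "\<integral>w. (Y w)\<^sup>2 \<partial>M" and ?c = "\<integral>w. \<bar>X w\<bar> * \<bar>Y w\<bar> \<partial>M"
  note XY = integrable_abs_mult_of_squares[OF assms]
  have c: "0 \<le> ?c" by (rule Bochner_Integration.integral_nonneg) simp
  \<comment> \<open>This is \<open>E (r \<bar>X\<bar> - \<bar>Y\<bar>)\<^sup>2\<close>; as a quadratic in \<open>r\<close> it has a discriminant that is not positive.\<close>
  have quad: "0 \<le> r\<^sup>2 * ?a - 2 * r * ?c + ?b" for r :: real
  proof -
    have "0 \<le> (\<integral>w. (r * \<bar>X w\<bar> - \<bar>Y w\<bar>)\<^sup>2 \<partial>M)"
      by (rule Bochner_Integration.integral_nonneg) simp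
    also have "(\<lambda>w. (r * \<bar>X w\<bar> - \<bar>Y w\<bar>)\<^sup>2) = (\<lambda>w. r\<^sup>2 * (X w)\<^sup>2 - 2 * r * (\<bar>X w\<bar> * \<bar>Y w\<bar>) + (Y w)\<^sup>2)"
      by (auto simp: power2_diff power_mult_distrib algebra_simps)
    also have "(\<integral>w. r\<^sup>2 * (X w)\<^sup>2 - 2 * r * (\<bar>X w\<bar> * \<bar>Y w\<bar>) + (Y w)\<^sup>2 \<partial>M) = r\<^sup>2 * ?a - 2 * r * ?c + ?b"
      using X Y XY by simp
    finally show ?thesis .
  qed
  have a0: "0 \<le> ?a" and b0: "0 \<le> ?b" by auto
  have "?c\<^sup>2 \<le> ?a * ?b"
  proof (cases "?a = 0")
    case True
    have "?c = 0"
    proof (rule ccontr)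
      assume "?c \<noteq> 0"
      then show False using quad[of "(?b + 1) / (2 * ?c)"] True by (simp add: field_simps)
    qed
    then show ?thesis using True by simp
  next
    case False
    then have pos: "0 < ?a" using a0 by linarith
    have "(?c / ?a)\<^sup>2 * ?a - 2 * (?c / ?a) * ?c + ?b = ?b - ?c\<^sup>2 / ?a"
      using pos by (simp add: field_simps power2_eq_square)
    then have "?c\<^sup>2 / ?a \<le> ?b" using quad[of "?c / ?a"] by simp
    then show ?thesis using pos by (simp add: field_simps)
  qed
  then show ?thesis
    using c by (simp add: real_sqrt_mult[symmetric] real_le_rsqrt)
qed

lemma gaussian_rv_cong_AE:
  assumes X: "gaussian_rv M X" and eq: "AE w in M. X w = Y w"
    and Y[measurable]: "Y \<in> borel_measurable M"
  shows "gaussian_rv M Y"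
proof -
  have [measurable]: "X \<in> borel_measurable M" using X by (simp add: gaussian_rv_def)
  have "distr M lborel X = distr M lborel Y"
    by (rule distr_cong_AE) (use eq in auto)
  then have "distributed M lborel Y f" if "distributed M lborel X f" for f
    using that by (auto simp: distributed_def)
  moreover have "AE w in M. Y w = c" if "AE w in M. X w = c" for c
    using that eq by eventually_elim simp
  ultimately show ?thesis
    using X Y unfolding gaussian_rv_def by blast
qed

context prob_space
begin

lemma gaussian_square_integrable:
  assumes "gaussian_rv M X"
  shows "integrable M (\<lambda>w. (X w)\<^sup>2)"
proof -
  have [measurable]: "X \<in> borel_measurable M" using assms by (simp add: gaussian_rv_def)
  consider m s where "0 < s" "distributed M lborel X (\<lambda>y. ennreal (normal_density m s y))"
    | c where "AE w in M. X w = c"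
    using assms by (auto simp: gaussian_rv_def)
  then show ?thesis
  proof cases
    case 1
    have i: "integrable lborel (\<lambda>y. normal_density m s y * (y - m)^2)"
      "integrable lborel (\<lambda>y. normal_density m s y * y)" "integrable lborel (normal_density m s)"
      using integrable_normal_moment[OF 1(1), of m 2] integrable_normal_moment_nz_1[OF 1(1), of m] 1(1) by auto
    have "integrable lborel (\<lambda>y. normal_density m s y * (y - m)^2 + 2 * m * (normal_density m s y * y) - m\<^sup>2 * normal_density m s y)"
      using i by simp
    then have "integrable lborel (\<lambda>y. normal_density m s y * y\<^sup>2)"
      by (rule Bochner_Integration.integrable_cong[THEN iffD1, rotated -1])
         (simp_all add: power2_eq_square algebra_simps)
    then show ?thesis
      using distributed_integrable[OF 1(2), of "\<lambda>y. y\<^sup>2"] by simp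
  next
    case 2
    have "integrable M (\<lambda>w. c\<^sup>2)" by simp
    then show ?thesis
      by (rule integrable_cong_AE[THEN iffD1, rotated -1]) (use 2 in auto)
  qed
qed

text \<open>The normal density with standard deviation \<open>s\<close> is at most \<open>1 / (s sqrt(2 pi)) \<le> 1 / (2s)\<close>, so
  the interval \<open>[-s/2, s/2]\<close> has probability at most \<open>1/2\<close>. A constant with mean \<open>0\<close> is
  \<open>0\<close> and equals its standard deviation.\<close>
lemma centered_gaussian_large:
  assumes X: "gaussian_rv M X" and E0: "expectation X = 0"
  shows "1/2 \<le> prob {w \<in> space M. sqrt (expectation (\<lambda>w. (X w)\<^sup>2)) / 2 \<le> \<bar>X w\<bar>}"
proof -
  have [measurable]: "X \<in> borel_measurable M" using X by (simp add: gaussian_rv_def)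
  consider m s where "0 < s" "distributed M lborel X (\<lambda>y. ennreal (normal_density m s y))"
    | c where "AE w in M. X w = c"
    using X by (auto simp: gaussian_rv_def)
  then show ?thesis
  proof cases
    case 1
    have m: "m = 0" using normal_distributed_expectation[OF 1] E0 by simp
    have sd: "sqrt (expectation (\<lambda>w. (X w)\<^sup>2)) = s"
      using normal_distributed_variance[OF 1] E0 1(1) by simp
    have dens: "normal_density m s y \<le> 1 / (2 * s)" for y
    proof -
      have "sqrt 4 \<le> sqrt (2 * pi)"
        using pi_gt3 by (intro real_sqrt_le_mono) simp
      then have "2 \<le> sqrt (2 * pi)" by simp
      then have "2 * s \<le> sqrt (2 * pi) * s" using 1(1) by simp
      then have "1 / sqrt (2 * pi * s\<^sup>2) \<le> 1 / (2 * s)"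
        using 1(1) by (simp add: real_sqrt_mult frac_le)
      moreover have "normal_density m s y \<le> 1 / sqrt (2 * pi * s\<^sup>2) * 1"
        unfolding normal_density_def by (intro mult_left_mono) auto
      ultimately show ?thesis by simp
    qed
    have "emeasure M (X -` {-s/2..s/2} \<inter> space M) = (\<integral>\<^sup>+ y. ennreal (normal_density m s y) * indicator {-s/2..s/2} y \<partial>lborel)"
      by (rule distributed_emeasure[OF 1(2)]) simp
    also have "\<dots> \<le> (\<integral>\<^sup>+ y. ennreal (1 / (2 * s)) * indicator {-s/2..s/2} y \<partial>lborel)"
      by (intro nn_integral_mono mult_right_mono ennreal_leI dens) simp
    also have "\<dots> = ennreal (1/2)"
      using 1(1) by (subst nn_integral_cmult_indicator) (auto simp: ennreal_mult[symmetric])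
    finally have "prob (X -` {-s/2..s/2} \<inter> space M) \<le> 1/2"
      unfolding emeasure_eq_measure by (rule ennreal_le_iff[THEN iffD1, rotated]) simp
    moreover have "1 - prob (X -` {-s/2..s/2} \<inter> space M) = prob (space M - (X -` {-s/2..s/2} \<inter> space M))"
      by (rule prob_compl[symmetric]) measurable
    moreover have "\<dots> \<le> prob {w \<in> space M. s / 2 \<le> \<bar>X w\<bar>}"
      by (rule finite_measure_mono) auto
    ultimately show ?thesis unfolding sd by linarith
  next
    case 2
    have "expectation X = expectation (\<lambda>_. c)"
      by (rule integral_cong_AE) (use 2 in auto)
    then have c: "c = 0" using E0 by (simp add: prob_space)
    have "expectation (\<lambda>w. (X w)\<^sup>2) = expectation (\<lambda>_. 0)"
      by (rule integral_cong_AE) (use 2 c in auto)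
    then have "{w \<in> space M. sqrt (expectation (\<lambda>w. (X w)\<^sup>2)) / 2 \<le> \<bar>X w\<bar>} = space M"
      by auto
    then show ?thesis by (simp add: prob_space)
  qed
qed

text \<open>On an event \<open>A\<close> of probability more than \<open>3/4\<close> the integral of \<open>\<bar>x(t)\<bar>\<close> is bounded by
  some \<open>n\<close>. For each \<open>t\<close>, the event \<open>A\<close> meets \<open>\<bar>x(t)\<bar> \<ge> sd(t) / 2\<close> with
  probability at least \<open>1/4\<close>. So \<open>sd(t) / 8\<close> is at most the expectation of \<open>\<bar>x(t)\<bar>\<close> over
  \<open>A\<close>, whose integral over \<open>t\<close> is at most \<open>n\<close>.\<close>
lemma centered_gaussian_sd_integrable:
  fixes x :: "real \<Rightarrow> 'a \<Rightarrow> real"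
  assumes meas: "case_prod x \<in> borel_measurable (lborel \<Otimes>\<^sub>M M)"
    and gauss: "\<And>t. gaussian_rv M (x t)" and centered: "\<And>t. expectation (x t) = 0"
    and paths: "AE w in M. set_integrable lborel {a..b} (\<lambda>t. x t w)"
  shows "set_integrable lborel {a..b} (\<lambda>t. sqrt (expectation (\<lambda>w. (x t w)\<^sup>2)))"
proof -
  have [measurable]: "(\<lambda>p. x (fst p) (snd p)) \<in> borel_measurable (lborel \<Otimes>\<^sub>M M)"
    using meas by (simp add: case_prod_beta')
  have xb[measurable]: "(\<lambda>p. x (fst p) (snd p)) \<in> borel_measurable (borel \<Otimes>\<^sub>M M)"
    using meas by (simp add: case_prod_beta' cong: measurable_cong_sets)
  have [measurable]: "(\<lambda>p. x (snd p) (fst p)) \<in> borel_measurable (M \<Otimes>\<^sub>M borel)"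
    using measurable_compose[OF _ xb, of "\<lambda>p. (snd p, fst p)" "M \<Otimes>\<^sub>M borel"] by simp
  have [measurable]: "x t \<in> borel_measurable M" for t
    using gauss by (simp add: gaussian_rv_def)
  interpret P: pair_sigma_finite lborel M ..
  define sd where "sd t = sqrt (expectation (\<lambda>w. (x t w)\<^sup>2))" for t
  have [measurable]: "sd \<in> borel_measurable lborel"
    unfolding sd_def by measurable
  have sd0: "0 \<le> sd t" for t by (simp add: sd_def)
  define Y where "Y w = (\<integral>\<^sup>+ t. ennreal (indicator {a..b} t * \<bar>x t w\<bar>) \<partial>lborel)" for w
  have Y[measurable]: "Y \<in> borel_measurable M"
    unfolding Y_def by measurable
  have Yfin: "AE w in M. Y w < \<infinity>"
    using paths
  proof eventually_elim
    fix w assume "set_integrable lborel {a..b} (\<lambda>t. x t w)"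
    then have "(\<integral>\<^sup>+ t. ennreal (norm (indicat_real {a..b} t *\<^sub>R x t w)) \<partial>lborel) < \<infinity>"
      unfolding set_integrable_def integrable_iff_bounded by simp
    then show "Y w < \<infinity>" by (simp add: Y_def abs_mult)
  qed
  define A where "A n = {w \<in> space M. Y w \<le> ennreal (real n)}" for n :: nat
  have A[measurable]: "A n \<in> sets M" for n unfolding A_def by measurable
  have "(\<lambda>n. prob (A n)) \<longlonglongrightarrow> prob (\<Union>n. A n)"
    by (rule finite_Lim_measure_incseq)
       (auto simp: incseq_def A_def intro: order_trans ennreal_leI)
  moreover have "prob (\<Union>n. A n) = 1"
  proof (rule AE_in_set_eq_1[THEN iffD1])
    show "AE w in M. w \<in> (\<Union>n. A n)"
      using Yfin AE_space
    proof eventually_elim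
      fix w assume w: "Y w < \<infinity>" "w \<in> space M"
      then obtain r where r: "0 \<le> r" "Y w = ennreal r" by (cases "Y w") auto
      obtain n :: nat where "r \<le> real n" using real_arch_simple by blast
      then show "w \<in> (\<Union>n. A n)" using w r by (auto simp: A_def intro!: exI[of _ n] ennreal_leI)
    qed
  qed measurable
  ultimately have "\<forall>\<^sub>F n in sequentially. 3/4 < prob (A n)"
    by (intro order_tendstoD) auto
  then obtain n where n: "3/4 < prob (A n)" by (auto simp: eventually_sequentially)
  have low: "ennreal (sd t / 8) \<le> (\<integral>\<^sup>+ w. ennreal \<bar>x t w\<bar> * indicator (A n) w \<partial>M)" for t
  proof -
    let ?L = "{w \<in> space M. sd t / 2 \<le> \<bar>x t w\<bar>}"
    have "1/2 \<le> prob ?L"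
      unfolding sd_def by (rule centered_gaussian_large[OF gauss centered])
    moreover have "prob (A n \<union> ?L) \<le> 1" by simp
    moreover have "prob (A n \<union> ?L) = prob (A n) + prob ?L - prob (A n \<inter> ?L)"
      by (subst measure_Un3) (auto simp: fmeasurable_eq_sets)
    ultimately have pr: "1/4 \<le> prob (A n \<inter> ?L)" using n by linarith
    have "ennreal (sd t / 8) \<le> ennreal (sd t / 2) * emeasure M (A n \<inter> ?L)"
      unfolding emeasure_eq_measure ennreal_mult[symmetric]
      using mult_left_mono[OF pr, of "sd t / 2"] sd0[of t]
      by (subst ennreal_mult[symmetric]) (auto intro!: ennreal_leI)
    also have "\<dots> = (\<integral>\<^sup>+ w. ennreal (sd t / 2) * indicator (A n \<inter> ?L) w \<partial>M)"
      by (rule nn_integral_cmult_indicator[symmetric]) measurable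
    also have "\<dots> \<le> (\<integral>\<^sup>+ w. ennreal \<bar>x t w\<bar> * indicator (A n) w \<partial>M)"
      by (intro nn_integral_mono) (auto simp: indicator_def intro!: ennreal_leI)
    finally show ?thesis .
  qed
  have "(\<integral>\<^sup>+ t. indicator {a..b} t * ennreal (sd t / 8) \<partial>lborel)
      \<le> (\<integral>\<^sup>+ t. indicator {a..b} t * (\<integral>\<^sup>+ w. ennreal \<bar>x t w\<bar> * indicator (A n) w \<partial>M) \<partial>lborel)"
    by (intro nn_integral_mono mult_left_mono low) simp
  also have "\<dots> = (\<integral>\<^sup>+ t. \<integral>\<^sup>+ w. indicator {a..b} t * (ennreal \<bar>x t w\<bar> * indicator (A n) w) \<partial>M \<partial>lborel)"
    by (intro nn_integral_cong nn_integral_cmult[symmetric]) measurable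
  also have "\<dots> = (\<integral>\<^sup>+ w. \<integral>\<^sup>+ t. indicator {a..b} t * (ennreal \<bar>x t w\<bar> * indicator (A n) w) \<partial>lborel \<partial>M)"
    by (rule P.Fubini'[symmetric]) measurable
  also have "\<dots> = (\<integral>\<^sup>+ w. Y w * indicator (A n) w \<partial>M)"
  proof (rule nn_integral_cong)
    fix w assume w: "w \<in> space M"
    have [measurable]: "(\<lambda>t. x t w) \<in> borel_measurable borel"
      using measurable_Pair1[OF xb w] by simp
    have "Y w * indicator (A n) w = (\<integral>\<^sup>+ t. ennreal (indicator {a..b} t * \<bar>x t w\<bar>) * indicator (A n) w \<partial>lborel)"
      unfolding Y_def by (rule nn_integral_multc[symmetric]) measurable
    also have "\<dots> = (\<integral>\<^sup>+ t. indicator {a..b} t * (ennreal \<bar>x t w\<bar> * indicator (A n) w) \<partial>lborel)"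
      by (rule nn_integral_cong) (auto simp: indicator_def)
    finally show "(\<integral>\<^sup>+ t. indicator {a..b} t * (ennreal \<bar>x t w\<bar> * indicator (A n) w) \<partial>lborel) = Y w * indicator (A n) w"
      by (rule sym)
  qed
  also have "\<dots> \<le> (\<integral>\<^sup>+ w. ennreal (real n) \<partial>M)"
    by (intro nn_integral_mono) (auto simp: A_def indicator_def)
  also have "\<dots> < \<infinity>" by (simp add: emeasure_space_1)
  finally have fin: "(\<integral>\<^sup>+ t. indicator {a..b} t * ennreal (sd t / 8) \<partial>lborel) < \<infinity>" .
  have "integrable lborel (\<lambda>t. indicat_real {a..b} t * (sd t / 8))"
  proof (rule integrableI_nonneg)
    have "(\<integral>\<^sup>+ t. ennreal (indicat_real {a..b} t * (sd t / 8)) \<partial>lborel) = (\<integral>\<^sup>+ t. indicator {a..b} t * ennreal (sd t / 8) \<partial>lborel)"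
      by (intro nn_integral_cong) (auto simp: indicator_def)
    then show "(\<integral>\<^sup>+ t. ennreal (indicat_real {a..b} t * (sd t / 8)) \<partial>lborel) < \<infinity>"
      using fin by simp
  qed (use sd0 in auto)
  then have "integrable lborel (\<lambda>t. 8 * (indicat_real {a..b} t * (sd t / 8)))"
    by (rule integrable_mult_right)
  then show ?thesis
    unfolding set_integrable_def sd_def[symmetric] by simp
qed

end

text \<open>The product \<open>x(t\<^sub>1) x(t\<^sub>2)\<close> has expected modulus at most \<open>sd(t\<^sub>1) sd(t\<^sub>2)\<close>, which is
  integrable over the square \<open>[-T, T]\<^sup>2\<close>; this makes Fubini applicable.\<close>
lemma (in prob_space) truncated_energy:
  fixes x :: "real \<Rightarrow> 'a \<Rightarrow> real"
  assumes meas: "case_prod x \<in> borel_measurable (lborel \<Otimes>\<^sub>M M)"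
    and gauss: "\<And>t. gaussian_rv M (x t)" and centered: "\<And>t. expectation (x t) = 0"
    and paths: "AE w in M. set_integrable lborel {-T..T} (\<lambda>t. x t w)"
  shows "complex_of_real (expectation (\<lambda>w. (cmod (truncated_ft x T \<omega> w))\<^sup>2)) =
    (\<integral>t. complex_of_real (autocorrelation M x t) *
      (indicator {-T..T} (fst t) * indicator {-T..T} (snd t) *
        exp (- (\<i> * complex_of_real (\<omega> * (fst t - snd t))))) \<partial>lborel)"
proof -
  have xb: "(\<lambda>p. x (fst p) (snd p)) \<in> borel_measurable (borel \<Otimes>\<^sub>M M)"
    using meas by (simp add: case_prod_beta' cong: measurable_cong_sets)
  have [measurable]: "x t \<in> borel_measurable M" for t
    using gauss by (simp add: gaussian_rv_def)
  have sq: "integrable M (\<lambda>w. (x t w)\<^sup>2)" for t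
    by (rule gaussian_square_integrable[OF gauss])
  define sd where "sd t = sqrt (expectation (\<lambda>w. (x t w)\<^sup>2))" for t
  have sd0: "0 \<le> sd t" for t by (simp add: sd_def)
  have sdi: "integrable lborel (\<lambda>t. indicat_real {-T..T} t * sd t)"
    using centered_gaussian_sd_integrable[OF meas gauss centered paths]
    by (simp add: set_integrable_def sd_def)
  interpret P: pair_sigma_finite M "lborel :: (real \<times> real) measure" ..
  define e where "e t = indicator {-T..T} (fst t) * indicator {-T..T} (snd t) *
    exp (- (\<i> * complex_of_real (\<omega> * (fst t - snd t))))" for t :: "real \<times> real"
  let ?F = "\<lambda>w t. complex_of_real (x (fst t) w * x (snd t) w) * e t"
  have [measurable]: "(\<lambda>p. x (fst (snd p)) (fst p)) \<in> borel_measurable (M \<Otimes>\<^sub>M (borel \<Otimes>\<^sub>M borel))"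
    using measurable_compose[OF _ xb, of "\<lambda>p. (fst (snd p), fst p)" "M \<Otimes>\<^sub>M (borel \<Otimes>\<^sub>M borel)"] by simp
  have [measurable]: "(\<lambda>p. x (snd (snd p)) (fst p)) \<in> borel_measurable (M \<Otimes>\<^sub>M (borel \<Otimes>\<^sub>M borel))"
    using measurable_compose[OF _ xb, of "\<lambda>p. (snd (snd p), fst p)" "M \<Otimes>\<^sub>M (borel \<Otimes>\<^sub>M borel)"] by simp
  have "(\<lambda>p. ?F (fst p) (snd p)) \<in> borel_measurable (M \<Otimes>\<^sub>M (borel \<Otimes>\<^sub>M borel))"
    unfolding e_def by measurable
  then have "(\<lambda>p. ?F (fst p) (snd p)) \<in> borel_measurable (M \<Otimes>\<^sub>M borel)"
    by (simp only: borel_prod)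
  then have mF: "case_prod ?F \<in> borel_measurable (M \<Otimes>\<^sub>M lborel)"
    unfolding case_prod_beta' by (simp only: sets_lborel cong: measurable_cong_sets sets_pair_measure_cong)
  have normF: "norm (?F w t) = \<bar>x (fst t) w\<bar> * \<bar>x (snd t) w\<bar> * (indicat_real {-T..T} (fst t) * indicat_real {-T..T} (snd t))" for w t
    by (auto simp: e_def norm_mult abs_mult indicator_def)
  have iF: "integrable (M \<Otimes>\<^sub>M lborel) (case_prod ?F)"
  proof (rule integrableI_bounded[OF mF])
    have "(\<integral>\<^sup>+ p. norm (case_prod ?F p) \<partial>(M \<Otimes>\<^sub>M lborel)) = (\<integral>\<^sup>+ t. \<integral>\<^sup>+ w. norm (?F w t) \<partial>M \<partial>lborel)"
      by (subst P.nn_integral_snd[symmetric]) (use mF in auto)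
    also have "\<dots> \<le> (\<integral>\<^sup>+ t. ennreal (indicat_real {-T..T} (fst t) * sd (fst t)) * ennreal (indicat_real {-T..T} (snd t) * sd (snd t)) \<partial>lborel)"
    proof (rule nn_integral_mono)
      fix t :: "real \<times> real"
      let ?i = "indicat_real {-T..T} (fst t) * indicat_real {-T..T} (snd t)"
      note ab = integrable_abs_mult_of_squares[of "x (fst t)" M "x (snd t)", OF _ _ sq sq]
      have "(\<integral>\<^sup>+ w. norm (?F w t) \<partial>M) = ennreal (expectation (\<lambda>w. \<bar>x (fst t) w\<bar> * \<bar>x (snd t) w\<bar> * ?i))"
        unfolding normF by (rule nn_integral_eq_integral) (use ab in auto)
      also have "\<dots> \<le> ennreal (sd (fst t) * sd (snd t) * ?i)"
      proof (rule ennreal_leI)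
        have "expectation (\<lambda>w. \<bar>x (fst t) w\<bar> * \<bar>x (snd t) w\<bar>) \<le> sd (fst t) * sd (snd t)"
          unfolding sd_def by (rule integral_abs_mult_le) (use sq in auto)
        then show "expectation (\<lambda>w. \<bar>x (fst t) w\<bar> * \<bar>x (snd t) w\<bar> * ?i) \<le> sd (fst t) * sd (snd t) * ?i"
          by (subst integral_mult_left_zero) (intro mult_right_mono, auto)
      qed
      also have "\<dots> = ennreal (indicat_real {-T..T} (fst t) * sd (fst t)) * ennreal (indicat_real {-T..T} (snd t) * sd (snd t))"
        using sd0 by (subst ennreal_mult[symmetric]) (auto simp: mult_ac)
      finally show "(\<integral>\<^sup>+ w. norm (?F w t) \<partial>M) \<le> ennreal (indicat_real {-T..T} (fst t) * sd (fst t)) * ennreal (indicat_real {-T..T} (snd t) * sd (snd t))" .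
    qed
    also have "\<dots> = (\<integral>\<^sup>+ a. ennreal (indicat_real {-T..T} a * sd a) \<partial>lborel) * (\<integral>\<^sup>+ b. ennreal (indicat_real {-T..T} b * sd b) \<partial>lborel)"
    proof -
      have [measurable]: "(\<lambda>t. indicat_real {-T..T} t * sd t) \<in> borel_measurable borel"
        using borel_measurable_integrable[OF sdi] by simp
      show ?thesis
        unfolding lborel_prod[symmetric]
        by (subst lborel.nn_integral_fst[symmetric]) (auto simp: nn_integral_cmult nn_integral_multc)
    qed
    also have "\<dots> < \<infinity>"
      using sd0 by (simp add: nn_integral_eq_integral[OF sdi] ennreal_mult_less_top)
    finally show "(\<integral>\<^sup>+ p. norm (case_prod ?F p) \<partial>(M \<Otimes>\<^sub>M lborel)) < \<infinity>" .
  qed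
  have path_energy: "complex_of_real ((cmod (truncated_ft x T \<omega> w))\<^sup>2) = (\<integral>t. ?F w t \<partial>lborel)"
    if w: "set_integrable lborel {-T..T} (\<lambda>t. x t w)" for w
  proof -
    let ?f = "\<lambda>t. complex_of_real (indicat_real {-T..T} t * x t w) * exp (- (\<i> * complex_of_real (\<omega> * t)))"
    have xi: "integrable lborel (\<lambda>t. indicat_real {-T..T} t * x t w)"
      using w by (simp add: set_integrable_def)
    have [measurable]: "(\<lambda>t. indicat_real {-T..T} t * x t w) \<in> borel_measurable borel"
      using borel_measurable_integrable[OF xi] by simp
    have f: "integrable lborel ?f"
    proof (rule Bochner_Integration.integrable_bound[OF xi])
      show "AE t in lborel. norm (?f t) \<le> norm (indicat_real {-T..T} t * x t w)"
        by (rule AE_I2) (simp add: norm_mult)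
    qed measurable
    have tr: "truncated_ft x T \<omega> w = (\<integral>t. ?f t \<partial>lborel)"
      unfolding truncated_ft_def set_lebesgue_integral_def
      by (rule Bochner_Integration.integral_cong) (auto simp: indicator_def)
    have "complex_of_real ((cmod (truncated_ft x T \<omega> w))\<^sup>2) = truncated_ft x T \<omega> w * cnj (truncated_ft x T \<omega> w)"
      by (rule complex_norm_square)
    also have "\<dots> = (\<integral>a. ?f a \<partial>lborel) * (\<integral>b. cnj (?f b) \<partial>lborel)"
      by (simp only: tr Bochner_Integration.integral_cnj)
    also have "\<dots> = (\<integral>t. ?f (fst t) * cnj (?f (snd t)) \<partial>lborel)"
      by (rule integral_tensor[symmetric, OF f integrable_cnj[OF f]])
    also have "\<dots> = (\<integral>t. ?F w t \<partial>lborel)"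
    proof (rule Bochner_Integration.integral_cong)
      fix t :: "real \<times> real"
      have "exp (- (\<i> * complex_of_real (\<omega> * (fst t - snd t))))
          = exp (- (\<i> * complex_of_real (\<omega> * fst t))) * cnj (exp (- (\<i> * complex_of_real (\<omega> * snd t))))"
        by (simp add: exp_cnj mult_exp_exp right_diff_distrib)
      then show "?f (fst t) * cnj (?f (snd t)) = ?F w t"
        unfolding e_def by (simp only: complex_cnj_mult) (auto simp: indicator_def)
    qed simp
    finally show ?thesis .
  qed
  have "complex_of_real (expectation (\<lambda>w. (cmod (truncated_ft x T \<omega> w))\<^sup>2))
      = (\<integral>w. complex_of_real ((cmod (truncated_ft x T \<omega> w))\<^sup>2) \<partial>M)"
    by (rule integral_complex_of_real[symmetric])
  also have "\<dots> = (\<integral>w. (\<integral>t. ?F w t \<partial>lborel) \<partial>M)"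
  proof (rule Bochner_Integration.integral_cong_AE)
    show int: "(\<lambda>w. \<integral>t. ?F w t \<partial>lborel) \<in> borel_measurable M"
      using P.integrable_fst[OF iF] by (rule borel_measurable_integrable)
    show "AE w in M. complex_of_real ((cmod (truncated_ft x T \<omega> w))\<^sup>2) = (\<integral>t. ?F w t \<partial>lborel)"
      using paths by eventually_elim (rule path_energy)
    have [measurable]: "(\<lambda>p. x (snd p) (fst p)) \<in> borel_measurable (M \<Otimes>\<^sub>M borel)"
      using measurable_compose[OF _ xb, of "\<lambda>p. (snd p, fst p)" "M \<Otimes>\<^sub>M borel"] by simp
    show "(\<lambda>w. complex_of_real ((cmod (truncated_ft x T \<omega> w))\<^sup>2)) \<in> borel_measurable M"
      unfolding truncated_ft_def set_lebesgue_integral_def by measurable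
  qed
  also have "\<dots> = (\<integral>t. (\<integral>w. ?F w t \<partial>M) \<partial>lborel)"
    by (rule P.Fubini_integral[OF iF, symmetric])
  also have "\<dots> = (\<integral>t. complex_of_real (autocorrelation M x t) * e t \<partial>lborel)"
  proof (rule Bochner_Integration.integral_cong)
    fix t :: "real \<times> real"
    have "(\<integral>w. complex_of_real (x (fst t) w * x (snd t) w) \<partial>M) = complex_of_real (autocorrelation M x t)"
      unfolding autocorrelation_def case_prod_beta' by (rule integral_complex_of_real)
    then show "(\<integral>w. ?F w t \<partial>M) = complex_of_real (autocorrelation M x t) * e t"
      by (simp only: integral_mult_left_zero)
  qed simp
  finally show ?thesis unfolding e_def .
qed

section \<open>Fourier transforms of planar test functions\<close>

definition fourier_kernel :: "real \<times> real \<Rightarrow> real \<times> real \<Rightarrow> complex" where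
  "fourier_kernel t p = exp (- (\<i> * complex_of_real (fst p * fst t - snd p * snd t)))"

lemma norm_fourier_kernel [simp]: "norm (fourier_kernel t p) = 1"
  by (simp add: fourier_kernel_def)

lemma fourier_kernel_measurable [measurable]: "(\<lambda>p. fourier_kernel t p) \<in> borel_measurable borel"
  unfolding fourier_kernel_def by (intro borel_measurable_continuous_onI continuous_intros)

lemma fourier_kernel_joint_measurable:
  "(\<lambda>z. fourier_kernel (fst z) (snd z)) \<in> borel_measurable (borel \<Otimes>\<^sub>M borel)"
proof -
  have "(\<lambda>z. fourier_kernel (fst z) (snd z)) \<in> borel_measurable ((borel \<Otimes>\<^sub>M borel) \<Otimes>\<^sub>M (borel \<Otimes>\<^sub>M borel))"
    unfolding fourier_kernel_def by measurable
  then show ?thesis by (simp only: borel_prod)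
qed

lemma ft2_eq: "ft2 f t = (\<integral>p. f p * fourier_kernel t p \<partial>lborel)"
  by (simp add: ft2_def fourier_kernel_def case_prod_beta')

text \<open>Support in an open square, written out by coordinates: this is the form in which a derivative
  inherits it and in which an integral along a horizontal line becomes one over an interval.\<close>
definition compactly_supported :: "(real \<times> real \<Rightarrow> complex) \<Rightarrow> bool" where
  "compactly_supported f \<longleftrightarrow> (\<exists>r>0. \<forall>p. f p \<noteq> 0 \<longrightarrow> \<bar>fst p\<bar> < r \<and> \<bar>snd p\<bar> < r)"

lemma Ck_continuous: "Ck n f \<Longrightarrow> continuous_on UNIV f"
proof (cases n)
  case (Suc m)
  assume "Ck n f"
  with Suc obtain f1 f2 where "\<And>p. (f has_derivative (\<lambda>v. fst v *\<^sub>R f1 p + snd v *\<^sub>R f2 p)) (at p)"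
    by auto
  then show ?thesis
    by (meson continuous_at_imp_continuous_on has_derivative_continuous)
qed simp

lemma integrable_compactly_supported:
  fixes f g :: "real \<times> real \<Rightarrow> complex"
  assumes c: "continuous_on UNIV f" and s: "compactly_supported f"
    and g[measurable]: "g \<in> borel_measurable borel" and g1: "\<And>p. norm (g p) \<le> 1"
  shows "integrable lborel (\<lambda>p. f p * g p)"
proof -
  obtain r where r: "\<And>p. f p \<noteq> 0 \<Longrightarrow> \<bar>fst p\<bar> < r \<and> \<bar>snd p\<bar> < r"
    using s unfolding compactly_supported_def by blast
  let ?K = "{(-r,-r)..(r,r)}"
  have cK: "compact ?K"
    by (metis compact_cbox cbox_interval)
  then have "compact (f ` ?K)"
    by (intro compact_continuous_image continuous_on_subset[OF c]) auto
  then obtain B where B: "\<And>p. p \<in> ?K \<Longrightarrow> norm (f p) \<le> B"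
    by (meson bounded_iff compact_imp_bounded imageI)
  have [measurable]: "f \<in> borel_measurable borel"
    using c by (rule borel_measurable_continuous_onI)
  show ?thesis
  proof (rule integrableI_bounded_set[where A = ?K and B = B])
    show "emeasure lborel ?K < \<infinity>"
      by (rule emeasure_bounded_finite[OF compact_imp_bounded[OF cK]])
    show "?K \<in> sets lborel" using cK by (simp add: borel_compact)
    show "AE p in lborel. p \<in> ?K \<longrightarrow> norm (f p * g p) \<le> B"
    proof (rule AE_I2, rule impI)
      fix p assume "p \<in> ?K"
      have "norm (f p) * norm (g p) \<le> norm (f p)" by (rule mult_left_le) (use g1 in auto)
      then show "norm (f p * g p) \<le> B" using B[OF \<open>p \<in> ?K\<close>] by (simp add: norm_mult)
    qed
    show "AE p in lborel. p \<notin> ?K \<longrightarrow> f p * g p = 0"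
    proof (rule AE_I2, rule impI)
      fix p assume "p \<notin> ?K"
      moreover have "p \<in> ?K" if "f p \<noteq> 0"
        using r[OF that] by (auto simp: less_eq_prod_def)
      ultimately have "f p = 0" by blast
      then show "f p * g p = 0" by simp
    qed
  qed measurable
qed

text \<open>The square is enlarged by \<open>1\<close> because \<open>f\<close> vanishes in a neighbourhood of each point outside the
  larger square.\<close>
lemma compactly_supported_derivative:
  fixes f f1 f2 :: "real \<times> real \<Rightarrow> complex"
  assumes d: "\<And>p. (f has_derivative (\<lambda>v. fst v *\<^sub>R f1 p + snd v *\<^sub>R f2 p)) (at p)"
    and s: "compactly_supported f"
  shows "compactly_supported f1"
proof -
  obtain r where r0: "0 < r" and r: "\<And>p. f p \<noteq> 0 \<Longrightarrow> \<bar>fst p\<bar> < r \<and> \<bar>snd p\<bar> < r"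
    using s unfolding compactly_supported_def by blast
  have "\<bar>fst p\<bar> < r + 1 \<and> \<bar>snd p\<bar> < r + 1" if "f1 p \<noteq> 0" for p
  proof (rule ccontr)
    assume far: "\<not> ?thesis"
    let ?U = "{q::real\<times>real. r < \<bar>fst q\<bar> \<or> r < \<bar>snd q\<bar>}"
    have U: "open ?U"
      by (intro open_Collect_disj open_Collect_less continuous_intros)
    have p: "p \<in> {q. r < \<bar>fst q\<bar> \<or> r < \<bar>snd q\<bar>}" using far by auto
    have z: "0 = f q" if "q \<in> {q. r < \<bar>fst q\<bar> \<or> r < \<bar>snd q\<bar>}" for q
      using r[of q] that by force
    have "(f has_derivative (\<lambda>v. 0)) (at p)"
      by (rule has_derivative_transform_within_open[OF has_derivative_const U p z])
    then have "(\<lambda>v. fst v *\<^sub>R f1 p + snd v *\<^sub>R f2 p) = (\<lambda>v. 0)"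
      using d[of p] by (rule has_derivative_unique[rotated])
    from fun_cong[OF this, of "(1, 0)"] show False using that by simp
  qed
  then show ?thesis using r0 unfolding compactly_supported_def by (intro exI[of _ "r + 1"]) auto
qed

text \<open>Integration by parts: the function \<open>?G\<close> in the proof is the derivative in \<open>u\<close> of
  \<open>f(u, v)\<close> times the kernel, so its integral along every horizontal line is \<open>0\<close>.\<close>
lemma ft2_derivative:
  fixes f f1 f2 :: "real \<times> real \<Rightarrow> complex"
  assumes d: "\<And>p. (f has_derivative (\<lambda>v. fst v *\<^sub>R f1 p + snd v *\<^sub>R f2 p)) (at p)"
    and s: "compactly_supported f" and c1: "continuous_on UNIV f1"
  shows "ft2 f1 t = \<i> * fst t * ft2 f t"
proof -
  have c: "continuous_on UNIV f"
    using d by (meson continuous_at_imp_continuous_on has_derivative_continuous)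
  have s1: "compactly_supported f1"
    by (rule compactly_supported_derivative[OF d s])
  obtain r where r0: "0 < r" and r: "\<And>p. f p \<noteq> 0 \<Longrightarrow> \<bar>fst p\<bar> < r \<and> \<bar>snd p\<bar> < r"
    using s unfolding compactly_supported_def by blast
  obtain r1 where r1: "\<And>p. f1 p \<noteq> 0 \<Longrightarrow> \<bar>fst p\<bar> < r1 \<and> \<bar>snd p\<bar> < r1"
    using s1 unfolding compactly_supported_def by blast
  define R where "R = max r r1"
  let ?G = "\<lambda>p. f1 p * fourier_kernel t p - \<i> * fst t * (f p * fourier_kernel t p)"
  have i: "integrable lborel (\<lambda>p. f p * fourier_kernel t p)" "integrable lborel (\<lambda>p. f1 p * fourier_kernel t p)"
    by (intro integrable_compactly_supported c c1 s s1; simp)+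
  then have G: "integrable (lborel \<Otimes>\<^sub>M lborel) ?G"
    by (simp add: lborel_prod)
  have zero: "(\<integral>u. ?G (u, v) \<partial>lborel) = 0" for v
  proof -
    have "(\<integral>u. indicator {-R..R} u *\<^sub>R ?G (u, v) \<partial>lborel) = f (R, v) * fourier_kernel t (R, v) - f (- R, v) * fourier_kernel t (- R, v)"
    proof (rule integral_FTC_Icc)
      show "- R \<le> R" using r0 by (simp add: R_def)
      show "((\<lambda>u. f (u, v) * fourier_kernel t (u, v)) has_vector_derivative ?G (u, v)) (at u within {-R..R})" for u
      proof -
        have "((\<lambda>u. (u, v)) has_derivative (\<lambda>h. (h, 0))) (at u)"
          by (intro has_derivative_Pair has_derivative_ident has_derivative_const)
        from has_derivative_compose[OF this d]
        have "((\<lambda>u. f (u, v)) has_derivative (\<lambda>h. h *\<^sub>R f1 (u, v))) (at u)"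
          by simp
        then have 1: "((\<lambda>u. f (u, v)) has_vector_derivative f1 (u, v)) (at u)"
          by (simp add: has_vector_derivative_def)
        have 2: "((\<lambda>u. fourier_kernel t (u, v)) has_vector_derivative (- (\<i> * fst t) * fourier_kernel t (u, v))) (at u)"
        proof -
          have "((\<lambda>z. exp (- (\<i> * (z * complex_of_real (fst t) - complex_of_real (v * snd t)))))
            has_field_derivative (- (\<i> * fst t) * fourier_kernel t (u, v))) (at (complex_of_real u))"
            unfolding fourier_kernel_def by (auto intro!: derivative_eq_intros)
          from has_vector_derivative_real_field[OF this]
          show ?thesis by (simp add: fourier_kernel_def)
        qed
        show ?thesis
          using has_vector_derivative_at_within[OF has_vector_derivative_mult[OF 1 2]]
          by (simp add: algebra_simps)
      qed
      show "continuous_on {-R..R} (\<lambda>u. ?G (u, v))"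
        unfolding fourier_kernel_def
        by (intro continuous_intros continuous_on_compose2[OF c] continuous_on_compose2[OF c1]) auto
    qed
    also have "\<dots> = 0"
    proof -
      have "\<not> \<bar>R\<bar> < r" by (auto simp: R_def)
      then have "f (R, v) = 0" "f (- R, v) = 0" using r[of "(R, v)"] r[of "(- R, v)"] by auto
      then show ?thesis by simp
    qed
    also have "(\<integral>u. indicator {-R..R} u *\<^sub>R ?G (u, v) \<partial>lborel) = (\<integral>u. ?G (u, v) \<partial>lborel)"
    proof (rule Bochner_Integration.integral_cong)
      fix u
      have "?G (u, v) = 0" if "u \<notin> {-R..R}"
      proof -
        have "\<not> \<bar>u\<bar> < r" "\<not> \<bar>u\<bar> < r1" using that by (auto simp: R_def)
        then have "f (u, v) = 0" "f1 (u, v) = 0" using r[of "(u, v)"] r1[of "(u, v)"] by auto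
        then show ?thesis by simp
      qed
      then show "indicator {-R..R} u *\<^sub>R ?G (u, v) = ?G (u, v)"
        by (cases "u \<in> {-R..R}") simp_all
    qed simp
    finally show ?thesis .
  qed
  have "(\<integral>p. ?G p \<partial>(lborel \<Otimes>\<^sub>M lborel)) = 0"
  proof -
    have e: "case_prod (\<lambda>u v. ?G (u, v)) = ?G" by auto
    show ?thesis
      using lborel_pair.integral_snd[of "\<lambda>u v. ?G (u, v)", unfolded e, OF G] unfolding zero by simp
  qed
  then have "(\<integral>p. ?G p \<partial>lborel) = 0" by (simp add: lborel_prod)
  then show ?thesis
    unfolding ft2_eq using i by (simp add: Bochner_Integration.integral_diff)
qed

text \<open>Two integrations by parts in the first variable turn \<open>t\<^sub>1\<^sup>2\<close> times the transform into
  the transform of a second derivative, which is bounded by its \<open>L\<^sup>1\<close> norm.\<close>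
lemma ft2_decay:
  fixes f :: "real \<times> real \<Rightarrow> complex"
  assumes Ck: "Ck 2 f" and s: "compactly_supported f"
  shows "\<exists>D. \<forall>a b. norm (ft2 f (a, b)) \<le> D * (1 / (1 + a\<^sup>2))"
proof -
  obtain f1 f2 where d: "\<And>p. (f has_derivative (\<lambda>v. fst v *\<^sub>R f1 p + snd v *\<^sub>R f2 p)) (at p)"
    and C1: "Ck (Suc 0) f1"
    using Ck by (auto simp: numeral_2_eq_2)
  obtain g1 g2 where d1: "\<And>p. (f1 has_derivative (\<lambda>v. fst v *\<^sub>R g1 p + snd v *\<^sub>R g2 p)) (at p)"
    and C2: "Ck 0 g1"
    using C1 by auto
  have s1: "compactly_supported f1" by (rule compactly_supported_derivative[OF d s])
  have s2: "compactly_supported g1" by (rule compactly_supported_derivative[OF d1 s1])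
  have bound: "norm (ft2 q t) \<le> (\<integral>p. norm (q p) \<partial>lborel)"
    if "continuous_on UNIV q" "compactly_supported q" for q t
  proof -
    have "norm (ft2 q t) \<le> (\<integral>p. norm (q p * fourier_kernel t p) \<partial>lborel)"
      unfolding ft2_eq by (rule integral_norm_bound)
    then show ?thesis by (simp add: norm_mult)
  qed
  let ?D = "(\<integral>p. norm (f p) \<partial>lborel) + (\<integral>p. norm (g1 p) \<partial>lborel)"
  have "norm (ft2 f (a, b)) \<le> ?D * (1 / (1 + a\<^sup>2))" for a b
  proof -
    have "ft2 g1 (a, b) = \<i> * a * (\<i> * a * ft2 f (a, b))"
      using ft2_derivative[OF d1 s1 Ck_continuous[OF C2], of "(a, b)"]
        ft2_derivative[OF d s Ck_continuous[OF C1], of "(a, b)"] by simp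
    then have "norm (ft2 g1 (a, b)) = a\<^sup>2 * norm (ft2 f (a, b))"
      by (simp add: norm_mult power2_eq_square)
    then have "(1 + a\<^sup>2) * norm (ft2 f (a, b)) = norm (ft2 f (a, b)) + norm (ft2 g1 (a, b))"
      by (simp add: algebra_simps)
    also have "\<dots> \<le> ?D"
      by (intro add_mono bound Ck_continuous[OF Ck] Ck_continuous[OF C2] s s2)
    finally have "(1 + a\<^sup>2) * norm (ft2 f (a, b)) \<le> ?D" .
    then have "norm (ft2 f (a, b)) \<le> ?D / (1 + a\<^sup>2)"
      by (subst pos_le_divide_eq) (auto simp: add_pos_nonneg mult.commute)
    then show ?thesis by simp
  qed
  then show ?thesis by blast
qed

lemma test_function_compactly_supported:
  assumes "\<phi> \<in> test_functions U"
  shows "compactly_supported \<phi>"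
proof -
  have "bounded {p. \<phi> p \<noteq> 0}"
    using assms compact_imp_bounded bounded_closure_image bounded_subset[OF _ closure_subset]
    by (auto simp: test_functions_def)
  then obtain r where r: "\<And>p. \<phi> p \<noteq> 0 \<Longrightarrow> norm p < r" "0 < r"
    by (auto simp: bounded_pos_less)
  have "\<bar>fst p\<bar> \<le> norm p" "\<bar>snd p\<bar> \<le> norm p" for p :: "real \<times> real"
    using norm_fst_le[of "fst p" "snd p"] norm_snd_le[of "snd p" "fst p"] by auto
  then show ?thesis
    unfolding compactly_supported_def using r by (meson le_less_trans)
qed

section \<open>The covariance as a tempered distribution\<close>

context noise_filter
begin

text \<open>The weight \<open>(1 + \<bar>t\<bar>)\<^sup>-\<^sup>2\<close> is already integrable in the first time, uniformly in the
  second.\<close>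
lemma covariance_tempered: "tempered_function covariance"
proof -
  let ?g = "\<lambda>t::real \<times> real. complex_of_real (1 / (1 + norm t)^2)"
  have "integrable lborel (\<lambda>t. complex_of_real (covariance t) * ?g t)"
  proof (rule covariance_integrable[OF _ integrable_inverse_square])
    show "norm (?g (a, b)) \<le> 1 / (1 + a\<^sup>2)" for a b
    proof -
      have "\<bar>a\<bar> \<le> norm (a, b)" using norm_fst_le[of a b] by simp
      then have "a\<^sup>2 \<le> (norm (a, b))\<^sup>2" by (metis abs_ge_zero power2_abs power_mono)
      moreover have "(norm (a, b))\<^sup>2 + 1 \<le> (1 + norm (a, b))\<^sup>2"
        by (simp add: power2_sum)
      ultimately have "1 + a\<^sup>2 \<le> (1 + norm (a, b))\<^sup>2" by linarith
      moreover have "norm (?g (a, b)) = 1 / (1 + norm (a, b))\<^sup>2"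
        by (simp only: norm_of_real) simp
      ultimately show ?thesis
        by (simp only:) (rule frac_le, auto simp: add_pos_nonneg)
    qed
  qed measurable
  then have "integrable lborel (\<lambda>t. covariance t * (1 / (1 + norm t)^2))"
    unfolding of_real_mult[symmetric] complex_of_real_integrable_eq .
  then show ?thesis
    unfolding tempered_function_def by (auto intro!: exI[of _ 2])
qed

lemma shifted_response_transform:
  "(\<integral>a. complex_of_real (h (a - s)) * exp (- (\<i> * complex_of_real (u * a))) \<partial>lborel)
     = exp (- (\<i> * complex_of_real (u * s))) * freq_response u"
  unfolding freq_response_def
proof (subst lborel_integral_real_affine[where t = s and c = 1])
  have "exp (- (\<i> * complex_of_real (u * (s + \<tau>))))
      = exp (- (\<i> * complex_of_real (u * s))) * exp (- (\<i> * complex_of_real (u * \<tau>)))" for \<tau>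
    by (simp add: mult_exp_exp distrib_left)
  then show "\<bar>1\<bar> *\<^sub>R (\<integral>\<tau>. complex_of_real (h (s + 1 * \<tau> - s)) * exp (- (\<i> * complex_of_real (u * (s + 1 * \<tau>)))) \<partial>lborel)
     = exp (- (\<i> * complex_of_real (u * s))) * (\<integral>\<tau>. complex_of_real (h \<tau>) * exp (- (\<i> * complex_of_real (u * \<tau>))) \<partial>lborel)"
    by (subst integral_mult_right_zero[symmetric]) (simp add: mult_ac)
qed simp

text \<open>For each \<open>s\<close>, pairing \<open>h(t\<^sub>1 - s) h(t\<^sub>2 - s)\<close> with the transform of \<open>\<phi>\<close> gives the
  integral of \<open>\<phi>(u, v) H(u) H(-v)\<close> times a phase, and one of the last two factors is \<open>0\<close>
  wherever \<open>\<phi>(u, v)\<close> is not. The minus sign comes from the opposite signs of the two frequencies in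
  the kernel.\<close>
lemma spectrum_vanishes:
  assumes \<phi>: "\<phi> \<in> test_functions {(u, v). \<bar>u\<bar> > W \<or> \<bar>v\<bar> > W}"
    and H: "\<And>\<omega>. \<bar>\<omega>\<bar> > W \<Longrightarrow> freq_response \<omega> = 0"
  shows "ft2_distribution covariance \<phi> = 0"
proof -
  have C: "Ck n \<phi>" for n using \<phi> by (auto simp: test_functions_def)
  note cs = test_function_compactly_supported[OF \<phi>]
  have \<phi>m[measurable]: "\<phi> \<in> borel_measurable borel"
    using Ck_continuous[OF C] by (rule borel_measurable_continuous_onI)
  note [measurable] = fourier_kernel_joint_measurable
  have gm: "ft2 \<phi> \<in> borel_measurable borel"
  proof -
    have "ft2 \<phi> \<in> borel_measurable lborel"
      unfolding ft2_eq[abs_def] by measurable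
    then show ?thesis by simp
  qed
  obtain D where D: "\<And>a b. norm (ft2 \<phi> (a, b)) \<le> D * (1 / (1 + a\<^sup>2))"
    using ft2_decay[OF C cs] by blast
  have k: "integrable lborel (\<lambda>a. D * (1 / (1 + a\<^sup>2)))"
    by (rule integrable_mult_right) (rule integrable_inverse_square)
  have support: "\<phi> p * (freq_response (fst p) * freq_response (- snd p)) = 0" for p
  proof (cases "\<phi> p = 0")
    case False
    then have "p \<in> {(u, v). \<bar>u\<bar> > W \<or> \<bar>v\<bar> > W}"
      using \<phi> closure_subset[of "{p. \<phi> p \<noteq> 0}"] by (auto simp: test_functions_def)
    then have "freq_response (fst p) = 0 \<or> freq_response (- snd p) = 0"
      using H[of "fst p"] H[of "- snd p"] by auto
    then show ?thesis by auto
  qed simp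
  have inner: "(\<integral>t. complex_of_real (h (fst t - s) * h (snd t - s)) * ft2 \<phi> t \<partial>lborel) = 0" for s
  proof -
    let ?hh = "\<lambda>t. complex_of_real (h (fst t - s) * h (snd t - s))"
    have hs: "integrable lborel (\<lambda>t. h (t - s))"
      using lborel_integrable_real_affine[OF response_integrable, of 1 "- s"] by simp
    have hh: "integrable lborel ?hh"
      using integrable_tensor[of "\<lambda>t. complex_of_real (h (t - s))" "\<lambda>t. complex_of_real (h (t - s))"] hs by simp
    have hhm[measurable]: "?hh \<in> borel_measurable borel"
      using borel_measurable_integrable[OF hh] by simp
    have \<phi>i: "integrable lborel \<phi>"
      using integrable_compactly_supported[OF Ck_continuous[OF C] cs, of "\<lambda>_. 1"] by simp
    have prod: "integrable (lborel \<Otimes>\<^sub>M lborel) (\<lambda>(t, p). ?hh t * (\<phi> p * fourier_kernel t p))"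
    proof (rule lborel_pair.Fubini_integrable)
      have "(\<lambda>z. ?hh (fst z) * (\<phi> (snd z) * fourier_kernel (fst z) (snd z))) \<in> borel_measurable (borel \<Otimes>\<^sub>M borel)"
        by (intro borel_measurable_times measurable_compose[OF measurable_fst hhm]
            measurable_compose[OF measurable_snd \<phi>m] fourier_kernel_joint_measurable)
      then show "(\<lambda>(t, p). ?hh t * (\<phi> p * fourier_kernel t p)) \<in> borel_measurable (lborel \<Otimes>\<^sub>M lborel)"
        by (simp only: case_prod_beta' cong: measurable_cong_sets) (simp cong: measurable_cong_sets)
      show "integrable lborel (\<lambda>t. \<integral>p. norm (case (t, p) of (t, p) \<Rightarrow> ?hh t * (\<phi> p * fourier_kernel t p)) \<partial>lborel)"
        using integrable_norm[OF hh] by (simp add: norm_mult)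
      show "AE t in lborel. integrable lborel (\<lambda>p. case (t, p) of (t, p) \<Rightarrow> ?hh t * (\<phi> p * fourier_kernel t p))"
        using integrable_compactly_supported[OF Ck_continuous[OF C] cs] by simp
    qed
    have "(\<integral>t. ?hh t * ft2 \<phi> t \<partial>lborel) = (\<integral>t. (\<integral>p. ?hh t * (\<phi> p * fourier_kernel t p) \<partial>lborel) \<partial>lborel)"
      unfolding ft2_eq by (simp only: integral_mult_right_zero)
    also have "\<dots> = (\<integral>p. (\<integral>t. ?hh t * (\<phi> p * fourier_kernel t p) \<partial>lborel) \<partial>lborel)"
      by (rule lborel_pair.Fubini_integral[OF prod, symmetric])
    also have "\<dots> = (\<integral>p. 0 \<partial>(lborel :: (real \<times> real) measure))"
    proof (rule Bochner_Integration.integral_cong)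
      fix p :: "real \<times> real"
      let ?f = "\<lambda>u a. complex_of_real (h (a - s)) * exp (- (\<i> * complex_of_real (u * a)))"
      have f: "integrable lborel (?f u)" for u
      proof (rule Bochner_Integration.integrable_bound[OF hs])
        show "AE a in lborel. norm (?f u a) \<le> norm (h (a - s))"
          by (rule AE_I2) (simp add: norm_mult)
      qed measurable
      have "(\<integral>t. ?hh t * (\<phi> p * fourier_kernel t p) \<partial>lborel)
          = (\<integral>t. \<phi> p * (?f (fst p) (fst t) * ?f (- snd p) (snd t)) \<partial>lborel)"
      proof (rule Bochner_Integration.integral_cong)
        fix t :: "real \<times> real"
        have "fourier_kernel t p = exp (- (\<i> * complex_of_real (fst p * fst t))) * exp (- (\<i> * complex_of_real (- snd p * snd t)))"
          by (simp add: fourier_kernel_def mult_exp_exp right_diff_distrib)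
        then show "?hh t * (\<phi> p * fourier_kernel t p) = \<phi> p * (?f (fst p) (fst t) * ?f (- snd p) (snd t))"
          by (simp only: of_real_mult mult_ac)
      qed simp
      also have "\<dots> = \<phi> p * ((\<integral>a. ?f (fst p) a \<partial>lborel) * (\<integral>b. ?f (- snd p) b \<partial>lborel))"
        by (simp only: integral_mult_right_zero integral_tensor[OF f f])
      also have "\<dots> = (exp (- (\<i> * complex_of_real (fst p * s))) * exp (- (\<i> * complex_of_real (- snd p * s)))) *
          (\<phi> p * (freq_response (fst p) * freq_response (- snd p)))"
        unfolding shifted_response_transform by (simp only: mult_ac)
      also have "\<dots> = 0" unfolding support by simp
      finally show "(\<integral>t. ?hh t * (\<phi> p * fourier_kernel t p) \<partial>lborel) = 0" .
    qed simp
    finally show ?thesis by simp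
  qed
  show ?thesis
    unfolding ft2_distribution_def covariance_integral[OF gm k D] inner by simp
qed

end

section \<open>Bandlimitation in both frequencies\<close>

theorem mainTheorem3:
  fixes M :: "'a measure" and x :: "real \<Rightarrow> 'a \<Rightarrow> real" and S :: "real \<Rightarrow> real" and B :: real
  assumes "prob_space M"
    and "random_signal M x"
    and "NS1 M x"
    and "has_psd M x S"
    and "\<exists>\<omega>. S \<omega> \<noteq> 0"
    and "B > 0"
    and "bandlimited S B"
  shows "tempered_function (autocorrelation M x) \<and> bandlimited2 (gen_psd M x) B"
proof -
  interpret prob_space M by fact
  have meas: "case_prod x \<in> borel_measurable (lborel \<Otimes>\<^sub>M M)"
    using assms(2) by (simp add: random_signal_def)
  obtain \<sigma>2 h W where \<sigma>2: "\<sigma>2 \<in> borel_measurable borel" "\<And>t. 0 \<le> \<sigma>2 t" "bdd_above (range \<sigma>2)"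
    and W: "white_noise M \<sigma>2 W" and h: "integrable lborel h"
    and test: "\<And>t. (\<lambda>s. h (t - s)) \<in> noise_test_functions \<sigma>2"
    and x: "\<And>t. AE w in M. x t w = W (\<lambda>s. h (t - s)) w"
    using assms(3) unfolding NS1_def by blast
  obtain C where C: "\<And>s. \<sigma>2 s \<le> C"
    using \<sigma>2(3) by (auto simp: bdd_above_def)
  interpret noise_filter \<sigma>2 h C
    by unfold_locales (use \<sigma>2 C h in auto)
  let ?f = "\<lambda>t s. h (t - s)"
  have xb: "(\<lambda>p. x (fst p) (snd p)) \<in> borel_measurable (borel \<Otimes>\<^sub>M M)"
    using meas by (simp add: case_prod_beta' cong: measurable_cong_sets)
  have xm[measurable]: "x t \<in> borel_measurable M" for t
    using measurable_Pair2[OF xb, of t] by simp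
  have Wg: "gaussian_rv M (W (?f t))" for t
  proof -
    have "gaussian_family M (noise_test_functions \<sigma>2) W"
      using W by (simp add: white_noise_def)
    from this[unfolded gaussian_family_def, rule_format, of "{?f t}" "\<lambda>_. 1"]
    show ?thesis using test[of t] by simp
  qed
  have Wm[measurable]: "W (?f t) \<in> borel_measurable M" for t
    using Wg by (simp add: gaussian_rv_def)
  have gauss: "gaussian_rv M (x t)" for t
  proof (rule gaussian_rv_cong_AE[OF Wg])
    show "AE w in M. W (?f t) w = x t w" using x[of t] by eventually_elim (rule sym)
  qed measurable
  have centered: "expectation (x t) = 0" for t
  proof -
    have "expectation (x t) = expectation (W (?f t))"
      by (rule integral_cong_AE[OF xm Wm x])
    also have "\<dots> = 0" using W test unfolding white_noise_def by blast
    finally show ?thesis .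
  qed
  \<comment> \<open>The shifted responses are square integrable for the intensity at every time, so the covariance of the noise gives this identity at every pair of times, not just almost everywhere.\<close>
  have R: "autocorrelation M x = covariance"
  proof
    fix t :: "real \<times> real"
    have "autocorrelation M x t = (\<integral>w. W (?f (fst t)) w * W (?f (snd t)) w \<partial>M)"
      unfolding autocorrelation_def case_prod_beta'
    proof (rule integral_cong_AE)
      show "AE w in M. x (fst t) w * x (snd t) w = W (?f (fst t)) w * W (?f (snd t)) w"
        using x[of "fst t"] x[of "snd t"] by eventually_elim simp
    qed measurable
    also have "\<dots> = covariance t"
      using W test unfolding white_noise_def covariance_def by blast
    finally show "autocorrelation M x t = covariance t" .
  qed
  have paths: "AE w in M. set_integrable lborel {-T..T} (\<lambda>t. x t w)" if "0 < T" for T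
    using assms(4) that by (simp add: has_psd_def)
  \<comment> \<open>Both sides are the covariance integrated against the same windowed kernel.\<close>
  have energy: "expectation (\<lambda>w. (cmod (truncated_ft x T \<omega> w))\<^sup>2)
      = (\<integral>s. \<sigma>2 s * (norm (windowed T \<omega> s))\<^sup>2 \<partial>lborel)" if T: "0 < T" for T \<omega>
    using truncated_energy[OF meas gauss centered paths[OF T], of \<omega>]
    unfolding R windowed_energy[OF T] of_real_eq_iff .
  have lim: "((\<lambda>T. 1 / (2 * T) * (\<integral>s. \<sigma>2 s * (norm (windowed T \<omega> s))\<^sup>2 \<partial>lborel)) \<longlongrightarrow> S \<omega>) at_top" for \<omega>
  proof (rule Lim_transform_eventually)
    show "((\<lambda>T. 1 / (2 * T) * expectation (\<lambda>w. (cmod (truncated_ft x T \<omega> w))\<^sup>2)) \<longlongrightarrow> S \<omega>) at_top"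
      using assms(4) by (simp add: has_psd_def)
    show "\<forall>\<^sub>F T in at_top. 1 / (2 * T) * expectation (\<lambda>w. (cmod (truncated_ft x T \<omega> w))\<^sup>2)
        = 1 / (2 * T) * (\<integral>s. \<sigma>2 s * (norm (windowed T \<omega> s))\<^sup>2 \<partial>lborel)"
      using eventually_gt_at_top[of 0] by eventually_elim (simp only: energy)
  qed
  obtain \<omega>0 where S0: "S \<omega>0 \<noteq> 0" using assms(5) by blast
  have H: "freq_response \<omega> = 0" if "2 * pi * B < \<bar>\<omega>\<bar>" for \<omega>
    by (rule freq_response_eq_0[OF lim S0]) (use assms(7) that in \<open>simp add: bandlimited_def\<close>)
  show ?thesis
    unfolding gen_psd_def R bandlimited2_def vanishes_on_def
    using covariance_tempered spectrum_vanishes[OF _ H] by blast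
qed

end
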